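(* Let $f:\mathbb{R}^3\to\mathcal{G}_3$ be a multivector-valued function which has the Clifford Fourier transform $\mathcal{F}\{f\}(\omega)$. Assume $\int_{\mathbb{R}^3}\|f(x)\|^2\,d^3x=F<\infty$. Then for arbitrary constant vectors $a,b\in\mathbb{R}^3$, $$\int_{\mathbb{R}^3}(a\cdot x)^2\,\|f(x)\|^2\,d^3x\;\int_{\mathbb{R}^3}(b\cdot\omega)^2\,\|\mathcal{F}\{f\}(\omega)\|^2\,d^3\omega\;\geq\;(a\cdot b)^2\,\frac{(2\pi)^3}{4}\,F^2 .$$
   Context: $\mathcal{G}_3=Cl_{3,0}$ is the real Clifford (geometric) algebra of Euclidean space $\mathbb{R}^3$ with orthonormal basis $e_1,e_2,e_3$: the associative unital $\mathbb{R}$-algebra generated by $e_1,e_2,e_3$ with $e_k^2=1$ and $e_je_k=-e_ke_j$ for $j\ne k$. It has the $8$-element real basis $\{e_A\}=\{1,e_1,e_2,e_3,e_{12},e_{31},e_{23},e_{123}\}$, where $e_{jk}=e_je_k$ and $e_{123}=e_1e_2e_3$. For $M=\sum_A\alpha_Ae_A$ with $\alpha_A\in\mathbb{R}$, $\|M\|^2=\langle M\widetilde{M}\rangle=\sum_A\alpha_A^2$, where $\widetilde{M}$ is the reverse of $M$ and $\langle\cdot\rangle$ is the scalar part. Put $i_3=e_{123}$; it satisfies $i_3^2=-1$ and commutes with every element of $\mathcal{G}_3$, and $e^{i_3t}=\cos t+i_3\sin t$ for $t\in\mathbb{R}$. The dot denotes the Euclidean inner product on $\mathbb{R}^3$, and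 $d^3x$, $d^3\omega$ denote Lebesgue measure. The Clifford Fourier transform (CFT) of $f:\mathbb{R}^3\to\mathcal{G}_3$ is the function $\mathcal{F}\{f\}:\mathbb{R}^3\to\mathcal{G}_3$ given by $$\mathcal{F}\{f\}(\omega)=\int_{\mathbb{R}^3}f(x)\,e^{-i_3\,\omega\cdot x}\,d^3x ,$$ understood in the usual $L^2$ (Plancherel) sense when $f\in L^2$ is not integrable. The integrals on the left of the inequality take values in $[0,\infty]$, with the convention $0\cdot\infty=0$. *)

theory Defs
  imports "HOL-Analysis.Analysis"
begin

section \<open>The geometric algebra of Euclidean 3-space\<close>

text \<open>A multivector is given by its eight real coordinates with respect to the basis
  1, e1, e2, e3, e12, e31, e23, e123 (in this order; note e31 = e3 e1, not e13).\<close>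

datatype g3 = G3 (sc: real) (c1: real) (c2: real) (c3: real)
                 (c12: real) (c31: real) (c23: real) (c123: real)

lemma g3_eq_iff:
  "M = N \<longleftrightarrow> sc M = sc N \<and> c1 M = c1 N \<and> c2 M = c2 N \<and> c3 M = c3 N \<and>
     c12 M = c12 N \<and> c31 M = c31 N \<and> c23 M = c23 N \<and> c123 M = c123 N"
  by (cases M; cases N) simp

instantiation g3 :: real_vector
begin

definition "0 = G3 0 0 0 0 0 0 0 0"

definition "M + N = G3 (sc M + sc N) (c1 M + c1 N) (c2 M + c2 N) (c3 M + c3 N) (c12 M + c12 N)
  (c31 M + c31 N) (c23 M + c23 N) (c123 M + c123 N)"

definition "M - N = G3 (sc M - sc N) (c1 M - c1 N) (c2 M - c2 N) (c3 M - c3 N) (c12 M - c12 N)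
  (c31 M - c31 N) (c23 M - c23 N) (c123 M - c123 N)"

definition "- M = G3 (- sc M) (- c1 M) (- c2 M) (- c3 M) (- c12 M) (- c31 M) (- c23 M) (- c123 M)"

definition "r *\<^sub>R M = G3 (r * sc M) (r * c1 M) (r * c2 M) (r * c3 M) (r * c12 M) (r * c31 M)
  (r * c23 M) (r * c123 M)"

instance
  by standard
    (simp_all add: g3_eq_iff zero_g3_def plus_g3_def minus_g3_def uminus_g3_def scaleR_g3_def
      algebra_simps)

end

text \<open>The product is the bilinear extension of the multiplication table of the basis blades;
  \<open>g3_generators\<close> below recovers the defining relations.\<close>

instantiation g3 :: real_algebra_1
begin

definition "1 = G3 1 0 0 0 0 0 0 0"

definition
  "M * N = G3
     (sc M * sc N + c1 M * c1 N + c2 M * c2 N + c3 M * c3 N - c12 M * c12 N - c31 M * c31 N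
       - c23 M * c23 N - c123 M * c123 N)
     (sc M * c1 N + c1 M * sc N - c2 M * c12 N + c3 M * c31 N + c12 M * c2 N - c31 M * c3 N
       - c23 M * c123 N - c123 M * c23 N)
     (sc M * c2 N + c1 M * c12 N + c2 M * sc N - c3 M * c23 N - c12 M * c1 N - c31 M * c123 N
       + c23 M * c3 N - c123 M * c31 N)
     (sc M * c3 N - c1 M * c31 N + c2 M * c23 N + c3 M * sc N - c12 M * c123 N + c31 M * c1 N
       - c23 M * c2 N - c123 M * c12 N)
     (sc M * c12 N + c1 M * c2 N - c2 M * c1 N + c3 M * c123 N + c12 M * sc N + c31 M * c23 N
       - c23 M * c31 N + c123 M * c3 N)
     (sc M * c31 N - c1 M * c3 N + c2 M * c123 N + c3 M * c1 N - c12 M * c23 N + c31 M * sc N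
       + c23 M * c12 N + c123 M * c2 N)
     (sc M * c23 N + c1 M * c123 N + c2 M * c3 N - c3 M * c2 N + c12 M * c31 N - c31 M * c12 N
       + c23 M * sc N + c123 M * c1 N)
     (sc M * c123 N + c1 M * c23 N + c2 M * c31 N + c3 M * c12 N + c12 M * c3 N + c31 M * c2 N
       + c23 M * c1 N + c123 M * sc N)"

instance
proof
  fix M N P :: g3 and r :: real
  show "(M * N) * P = M * (N * P)"
    by (simp only: g3_eq_iff times_g3_def g3.sel)
      (intro conjI; simp only: diff_conv_add_uminus distrib_left distrib_right mult_minus_left
        mult_minus_right minus_add_distrib minus_minus mult.assoc add_ac)
  show "(M + N) * P = M * P + N * P" "M * (N + P) = M * N + M * P"
    "(r *\<^sub>R M) * N = r *\<^sub>R (M * N)" "M * (r *\<^sub>R N) = r *\<^sub>R (M * N)"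
    by (simp_all add: g3_eq_iff plus_g3_def scaleR_g3_def times_g3_def algebra_simps)
qed (simp_all add: g3_eq_iff zero_g3_def one_g3_def times_g3_def)

end

text \<open>The norm is the Euclidean norm of the coordinate vector; \<open>norm_g3_reverse\<close> below relates
  it to the reverse.\<close>

instantiation g3 :: real_inner
begin

definition "inner M N = sc M * sc N + c1 M * c1 N + c2 M * c2 N + c3 M * c3 N + c12 M * c12 N
  + c31 M * c31 N + c23 M * c23 N + c123 M * c123 N"

definition "norm M = sqrt ((sc M)\<^sup>2 + (c1 M)\<^sup>2 + (c2 M)\<^sup>2 + (c3 M)\<^sup>2
  + (c12 M)\<^sup>2 + (c31 M)\<^sup>2 + (c23 M)\<^sup>2 + (c123 M)\<^sup>2)"

definition "dist M N = norm (M - N :: g3)"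

definition "sgn M = (M :: g3) /\<^sub>R norm M"

definition "(uniformity :: (g3 \<times> g3) filter) = (INF e\<in>{0<..}. principal {(M, N). dist M N < e})"

definition "open (U :: g3 set) \<longleftrightarrow> (\<forall>M\<in>U. eventually (\<lambda>(M', N). M' = M \<longrightarrow> N \<in> U) uniformity)"

instance
proof
  fix M N P :: g3 and r :: real
  show "inner M M = 0 \<longleftrightarrow> M = 0"
    unfolding inner_g3_def g3_eq_iff zero_g3_def g3.sel
    by (simp only: add_nonneg_eq_0_iff add_nonneg_nonneg zero_le_square mult_eq_0_iff
        disj_absorb conj_assoc)
  show "0 \<le> inner M M"
    unfolding inner_g3_def by (intro add_nonneg_nonneg zero_le_square)
  show "dist M N = norm (M - N)"
    by (simp add: dist_g3_def)
  show "norm M = sqrt (inner M M)"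
    by (simp add: norm_g3_def inner_g3_def power2_eq_square)
  show "inner M N = inner N M"
    by (simp add: inner_g3_def mult.commute)
  show "inner (M + N) P = inner M P + inner N P" "inner (r *\<^sub>R M) N = r * inner M N"
    by (simp_all add: inner_g3_def plus_g3_def scaleR_g3_def ring_distribs)
qed (simp_all only: sgn_g3_def uniformity_g3_def open_g3_def)

end

definition "e\<^sub>1 = G3 0 1 0 0 0 0 0 0"
definition "e\<^sub>2 = G3 0 0 1 0 0 0 0 0"
definition "e\<^sub>3 = G3 0 0 0 1 0 0 0 0"

definition i3 :: g3
  where "i3 = e\<^sub>1 * e\<^sub>2 * e\<^sub>3"

lemma g3_vectors:
  "1 = G3 1 0 0 0 0 0 0 0"
  "e\<^sub>1 = G3 0 1 0 0 0 0 0 0" "e\<^sub>2 = G3 0 0 1 0 0 0 0 0" "e\<^sub>3 = G3 0 0 0 1 0 0 0 0"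
  by (rule one_g3_def e\<^sub>1_def e\<^sub>2_def e\<^sub>3_def)+

lemma g3_blades:
  "e\<^sub>1 * e\<^sub>2 = G3 0 0 0 0 1 0 0 0" "e\<^sub>3 * e\<^sub>1 = G3 0 0 0 0 0 1 0 0"
  "e\<^sub>2 * e\<^sub>3 = G3 0 0 0 0 0 0 1 0" "i3 = G3 0 0 0 0 0 0 0 1"
  by (simp_all add: i3_def g3_vectors times_g3_def)

text \<open>The instance of class \<open>euclidean_space\<close> makes Bochner integrals of g3-valued functions
  available.\<close>

instantiation g3 :: euclidean_space
begin

definition "Basis = {1, e\<^sub>1, e\<^sub>2, e\<^sub>3, e\<^sub>1 * e\<^sub>2, e\<^sub>3 * e\<^sub>1, e\<^sub>2 * e\<^sub>3, i3}"

instance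
proof
  fix M N :: g3
  show "inner M N = (if M = N then 1 else 0)" if "M \<in> Basis" "N \<in> Basis"
    using that unfolding Basis_g3_def g3_blades unfolding g3_vectors
    by (elim insertE emptyE) (simp_all add: inner_g3_def)
  show "(\<forall>N\<in>Basis. inner M N = 0) \<longleftrightarrow> M = 0"
    unfolding Basis_g3_def g3_blades unfolding g3_vectors
    by (cases M) (simp add: inner_g3_def zero_g3_def)
qed (auto simp: Basis_g3_def)

end

lemma g3_generators:
  "e\<^sub>1 * e\<^sub>1 = 1" "e\<^sub>2 * e\<^sub>2 = 1" "e\<^sub>3 * e\<^sub>3 = 1"
  "e\<^sub>1 * e\<^sub>2 = - (e\<^sub>2 * e\<^sub>1)" "e\<^sub>2 * e\<^sub>3 = - (e\<^sub>3 * e\<^sub>2)" "e\<^sub>3 * e\<^sub>1 = - (e\<^sub>1 * e\<^sub>3)"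
  by (simp_all add: g3_vectors times_g3_def uminus_g3_def)

lemma g3_expansion:
  "M = sc M *\<^sub>R 1 + c1 M *\<^sub>R e\<^sub>1 + c2 M *\<^sub>R e\<^sub>2
    + c3 M *\<^sub>R e\<^sub>3 + c12 M *\<^sub>R (e\<^sub>1 * e\<^sub>2)
     + c31 M *\<^sub>R (e\<^sub>3 * e\<^sub>1) + c23 M *\<^sub>R (e\<^sub>2 * e\<^sub>3)
       + c123 M *\<^sub>R i3"
  unfolding g3_blades unfolding g3_vectors by (simp add: plus_g3_def scaleR_g3_def)

lemma i3_square: "i3 * i3 = - 1"
  by (simp add: g3_blades g3_vectors times_g3_def uminus_g3_def)

lemma i3_central: "i3 * M = M * i3"
  by (simp add: g3_blades times_g3_def)

definition reverse :: "g3 \<Rightarrow> g3"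
  where "reverse M = G3 (sc M) (c1 M) (c2 M) (c3 M) (- c12 M) (- c31 M) (- c23 M) (- c123 M)"

lemma reverse_mult: "reverse (M * N) = reverse N * reverse M"
  by (simp add: reverse_def times_g3_def algebra_simps)

lemma norm_g3_reverse: "(norm M)\<^sup>2 = sc (M * reverse M)"
  by (simp add: norm_g3_def reverse_def times_g3_def power2_eq_square)


section \<open>The Clifford Fourier transform\<close>

text \<open>exp (i3 t).  The norm of g3 is not submultiplicative, so the library's \<open>exp\<close> does not apply
  to this type.\<close>

definition cis3 :: "real \<Rightarrow> g3"
  where "cis3 t = cos t *\<^sub>R 1 + sin t *\<^sub>R i3"

definition square_integrable :: "(real^3 \<Rightarrow> g3) \<Rightarrow> bool"
  where "square_integrable f \<longleftrightarrow>
    f \<in> borel_measurable lebesgue \<and> (\<integral>\<^sup>+ x. ennreal ((norm (f x))\<^sup>2) \<partial>lebesgue) < \<infinity>"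

definition tendsto_L2 :: "(nat \<Rightarrow> real^3 \<Rightarrow> g3) \<Rightarrow> (real^3 \<Rightarrow> g3) \<Rightarrow> bool"
  where "tendsto_L2 h f \<longleftrightarrow>
    (\<lambda>n. \<integral>\<^sup>+ x. ennreal ((norm (h n x - f x))\<^sup>2) \<partial>lebesgue) \<longlonglongrightarrow> 0"

definition cft_integral :: "(real^3 \<Rightarrow> g3) \<Rightarrow> real^3 \<Rightarrow> g3"
  where "cft_integral f \<omega> = (LINT x|lebesgue. f x * cis3 (- (\<omega> \<bullet> x)))"

text \<open>The Plancherel transform is the continuous extension of \<open>cft_integral\<close> from
  the intersection of L1 and L2 to L2.  As it is determined only up to null sets, it is
  rendered as a relation: g is a version of the transform of f.\<close>

definition has_plancherel_cft :: "(real^3 \<Rightarrow> g3) \<Rightarrow> (real^3 \<Rightarrow> g3) \<Rightarrow> bool"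
  where "has_plancherel_cft f g \<longleftrightarrow>
    square_integrable f \<and> square_integrable g \<and>
    (\<exists>h. (\<forall>n. integrable lebesgue (h n) \<and> square_integrable (h n)) \<and>
         tendsto_L2 h f \<and> tendsto_L2 (\<lambda>n. cft_integral (h n)) g)"

definition has_cft :: "(real^3 \<Rightarrow> g3) \<Rightarrow> (real^3 \<Rightarrow> g3) \<Rightarrow> bool"
  where "has_cft f g \<longleftrightarrow>
    (if integrable lebesgue f then g = cft_integral f else has_plancherel_cft f g)"

end

theory Submission
  imports Defs "HOL-Probability.Characteristic_Functions"
begin

text \<open>
  Differentiation of f is avoided by working with translations.  Under the transform,
  f(x + t b) - f(x) becomes the transform of f times a factor of modulus
  \<open>|2 sin (t (b \<bullet> \<omega>) / 2)| \<le> |t (b \<bullet> \<omega>)|\<close>, so Plancherel bounds the squared L2 norm of this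
  difference by \<open>t\<^sup>2 / (2 \<pi>)\<^sup>3\<close> times the second moment of the transform in direction b.
  On the other hand, the integral of
  \<open>(a \<bullet> x) (|f(x + t b / 2)|\<^sup>2 - |f(x - t b / 2)|\<^sup>2)\<close> equals \<open>- t (a \<bullet> b) F\<close> by translation
  invariance, while its integrand is the inner product of f(x + t b / 2) - f(x - t b / 2) with
  \<open>(a \<bullet> x) (f(x + t b / 2) + f(x - t b / 2))\<close>.  The Cauchy-Schwarz inequality and \<open>t \<rightarrow> 0\<close>
  give the theorem.  Of Plancherel only the lower bound for the norm of the transform is needed,
  first for complex functions in L1 and L2 by Gaussian regularisation, and then for all of L2 by
  passing to the limit.
\<close>

section \<open>Continuity of translations in L2\<close>

text \<open>f carries no smoothness and either moment may be infinite, so a directional derivative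
  of f would first have to be constructed; translation differences always exist, and their bound is
  uniform in t. The algebra is noncommutative and its norm is not submultiplicative, but
  \<open>i3\<close> is central with square -1. The transform is therefore four complex Fourier
  transforms side by side, and the harmonic analysis can be done for complex functions.

  In the constant, (2 pi)^3 comes from Plancherel for a transform without normalising factor, and
  1/4 comes from |u + v|^2 \<le> 2 |u|^2 + 2 |v|^2, applied to two translates of f whose second
  moments add up. The convention 0 * \<infinity> = 0 makes vanishing moments a case of their own: a
  zero moment must force f to vanish almost everywhere. For the frequency moment this takes
  Plancherel for f itself, besides Plancherel for its differences. Squared norms are kept in
  \<open>ennreal\<close>, so that estimates can be stated before finiteness is known.\<close>

definition nsq :: "'a measure \<Rightarrow> ('a \<Rightarrow> 'b::real_normed_vector) \<Rightarrow> ennreal"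
  where "nsq M f = (\<integral>\<^sup>+ x. ennreal ((norm (f x))\<^sup>2) \<partial>M)"

text \<open>Young's inequality for the cross term 2 |u| |v|. The weight d = 1 gives the crude factor
  2 on both squares; letting d tend to 0 keeps the constant sharp when an inequality is passed to an
  L2 limit.\<close>

lemma norm_add_square_le:
  fixes u v :: "'a::real_normed_vector"
  assumes "0 < d"
  shows "(norm (u + v))\<^sup>2 \<le> (1 + d) * (norm u)\<^sup>2 + (1 + 1 / d) * (norm v)\<^sup>2"
proof -
  have "(norm (u + v))\<^sup>2 \<le> (norm u + norm v)\<^sup>2"
    by (intro power_mono norm_triangle_ineq norm_ge_zero)
  also have "\<dots> \<le> (1 + d) * (norm u)\<^sup>2 + (1 + 1 / d) * (norm v)\<^sup>2"
  proof -
    have "0 \<le> (sqrt d * norm u - norm v / sqrt d)\<^sup>2" by simp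
    also have "\<dots> = d * (norm u)\<^sup>2 + (norm v)\<^sup>2 / d - 2 * (norm u * norm v)"
      using assms by (simp add: power2_diff power_mult_distrib power_divide)
    finally show ?thesis by (simp add: power2_sum algebra_simps)
  qed
  finally show ?thesis .
qed

lemma nsq_add_le:
  fixes f g :: "'a \<Rightarrow> 'b::{real_normed_vector, second_countable_topology}"
  assumes [measurable]: "f \<in> borel_measurable M" "g \<in> borel_measurable M" and d: "0 < d"
  shows "nsq M (\<lambda>x. f x + g x) \<le> ennreal (1 + d) * nsq M f + ennreal (1 + 1 / d) * nsq M g"
proof -
  have "nsq M (\<lambda>x. f x + g x) \<le> (\<integral>\<^sup>+ x. ennreal (1 + d) * ennreal ((norm (f x))\<^sup>2)
      + ennreal (1 + 1 / d) * ennreal ((norm (g x))\<^sup>2) \<partial>M)"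
    unfolding nsq_def
  proof (rule nn_integral_mono)
    fix x
    have "ennreal ((norm (f x + g x))\<^sup>2)
        \<le> ennreal ((1 + d) * (norm (f x))\<^sup>2 + (1 + 1 / d) * (norm (g x))\<^sup>2)"
      using norm_add_square_le[OF d] by (rule ennreal_leI)
    then show "ennreal ((norm (f x + g x))\<^sup>2)
        \<le> ennreal (1 + d) * ennreal ((norm (f x))\<^sup>2) + ennreal (1 + 1 / d) * ennreal ((norm (g x))\<^sup>2)"
      using d by (simp add: ennreal_plus[symmetric] ennreal_mult[symmetric] del: ennreal_plus)
  qed
  also have "\<dots> = ennreal (1 + d) * nsq M f + ennreal (1 + 1 / d) * nsq M g"
    unfolding nsq_def by (subst nn_integral_add) (auto simp: nn_integral_cmult)
  finally show ?thesis .
qed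

lemma nsq_add_le_2:
  fixes f g :: "'a \<Rightarrow> 'b::{real_normed_vector, second_countable_topology}"
  assumes "f \<in> borel_measurable M" "g \<in> borel_measurable M"
  shows "nsq M (\<lambda>x. f x + g x) \<le> 2 * nsq M f + 2 * nsq M g"
  using nsq_add_le[OF assms, of 1] by simp

lemma nsq_minus_commute: "nsq M (\<lambda>x. f x - g x) = nsq M (\<lambda>x. g x - f x)"
  by (simp add: nsq_def norm_minus_commute)

lemma nsq_diff_le_2:
  fixes f g :: "'a \<Rightarrow> 'b::{real_normed_vector, second_countable_topology}"
  assumes [measurable]: "f \<in> borel_measurable M" "g \<in> borel_measurable M"
  shows "nsq M (\<lambda>x. f x - g x) \<le> 2 * nsq M f + 2 * nsq M g"
  using nsq_add_le_2[of f M "\<lambda>x. - g x"] by (simp add: nsq_def)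

section \<open>Translation invariance and the class of functions with L2-continuous
  translations\<close>

lemma nn_integral_lborel_translate:
  fixes c :: "'a::euclidean_space"
  assumes [measurable]: "f \<in> borel_measurable borel"
  shows "(\<integral>\<^sup>+ x. f (x + c) \<partial>lborel) = (\<integral>\<^sup>+ x. f x \<partial>lborel)"
proof -
  have "(\<integral>\<^sup>+ x. f x \<partial>lborel) = (\<integral>\<^sup>+ x. f x \<partial>distr lborel borel ((+) c))"
    by (simp add: lborel_distr_plus)
  also have "\<dots> = (\<integral>\<^sup>+ x. f (x + c) \<partial>lborel)"
    by (subst nn_integral_distr) (auto simp: add.commute)
  finally show ?thesis ..
qed

lemma nsq_lborel_translate:
  fixes c :: "'a::euclidean_space" and f :: "'a \<Rightarrow> 'b::{real_normed_vector, second_countable_topology}"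
  assumes [measurable]: "f \<in> borel_measurable borel"
  shows "nsq lborel (\<lambda>x. f (x + c)) = nsq lborel f"
  unfolding nsq_def by (rule nn_integral_lborel_translate[of "\<lambda>x. ennreal ((norm (f x))\<^sup>2)"]) simp

text \<open>Measurability and finite norm are bundled with continuity of translation at 0, so that
  closure under sums and approximation carries all three together. Sequences are used because
  dominated convergence is available for them.\<close>

definition L2_continuous :: "('a::euclidean_space \<Rightarrow> 'b::real_normed_vector) \<Rightarrow> bool"
  where "L2_continuous f \<longleftrightarrow> f \<in> borel_measurable borel \<and> nsq lborel f < \<infinity> \<and>
    (\<forall>z. z \<longlonglongrightarrow> 0 \<longrightarrow> (\<lambda>n::nat. nsq lborel (\<lambda>x. f (x + z n)
        - f x)) \<longlonglongrightarrow> 0)"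

lemma L2_continuousD:
  "L2_continuous f \<Longrightarrow> f \<in> borel_measurable borel"
  "L2_continuous f \<Longrightarrow> nsq lborel f < \<infinity>"
  "L2_continuous f \<Longrightarrow> z \<longlonglongrightarrow> 0 \<Longrightarrow> (\<lambda>n. nsq lborel (\<lambda>x. f (x + z n) - f x)) \<longlonglongrightarrow> 0"
  by (auto simp: L2_continuous_def)

lemma L2_continuous_add:
  fixes f g :: "'a::euclidean_space \<Rightarrow> 'b::{real_normed_vector, second_countable_topology}"
  assumes f: "L2_continuous f" and g: "L2_continuous g"
  shows "L2_continuous (\<lambda>x. f x + g x)"
proof -
  note [measurable] = L2_continuousD(1)[OF f] L2_continuousD(1)[OF g]
  have "nsq lborel (\<lambda>x. f x + g x) \<le> 2 * nsq lborel f + 2 * nsq lborel g"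
    by (rule nsq_add_le_2) auto
  also have "\<dots> < \<infinity>"
    using L2_continuousD(2)[OF f] L2_continuousD(2)[OF g] by (simp add: ennreal_mult_less_top)
  finally have 1: "nsq lborel (\<lambda>x. f x + g x) < \<infinity>" .
  have 2: "(\<lambda>n. nsq lborel (\<lambda>x. f (x + z n) + g (x + z n) - (f x + g x)))
      \<longlonglongrightarrow> 0" if z: "z \<longlonglongrightarrow> 0" for z
  proof (rule tendsto_sandwich[OF _ _ tendsto_const])
    show "(\<lambda>n. 2 * nsq lborel (\<lambda>x. f (x + z n) - f x) + 2 * nsq lborel (\<lambda>x. g (x + z n) - g x))
        \<longlonglongrightarrow> 0"
      using tendsto_add[OF ennreal_tendsto_cmult[OF _ L2_continuousD(3)[OF f z], of 2]
        ennreal_tendsto_cmult[OF _ L2_continuousD(3)[OF g z], of 2]] by simp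
    have "nsq lborel (\<lambda>x. f (x + z n) + g (x + z n) - (f x + g x))
      \<le> 2 * nsq lborel (\<lambda>x. f (x + z n) - f x) + 2 * nsq lborel (\<lambda>x. g (x + z n) - g x)" for n
      using nsq_add_le_2[of "\<lambda>x. f (x + z n) - f x" lborel "\<lambda>x. g (x + z n) - g x"]
      by (simp add: algebra_simps)
    then show "\<forall>\<^sub>F n in sequentially. nsq lborel (\<lambda>x. f (x + z n) + g (x + z n) - (f x + g x))
      \<le> 2 * nsq lborel (\<lambda>x. f (x + z n) - f x) + 2 * nsq lborel (\<lambda>x. g (x + z n) - g x)"
      by simp
  qed auto
  show ?thesis using 1 2 by (simp add: L2_continuous_def)
qed

lemma L2_continuous_zero: "L2_continuous (\<lambda>x::'a::euclidean_space. 0::'b::real_normed_vector)"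
  by (simp add: L2_continuous_def nsq_def)

lemma L2_continuous_sum:
  fixes f :: "'i \<Rightarrow> 'a::euclidean_space \<Rightarrow> 'b::{real_normed_vector, second_countable_topology}"
  assumes "finite I" "\<And>i. i \<in> I \<Longrightarrow> L2_continuous (f i)"
  shows "L2_continuous (\<lambda>x. \<Sum>i\<in>I. f i x)"
  using assms by (induction rule: finite_induct) (auto intro: L2_continuous_zero L2_continuous_add)

text \<open>Closure under L2 approximation. Translation is an isometry, so f - g and its translate
  are equally small, and only the difference of g and its translate depends on the shift.\<close>

lemma L2_continuous_approx:
  fixes f :: "'a::euclidean_space \<Rightarrow> 'b::{real_normed_vector, second_countable_topology}"
  assumes f[measurable]: "f \<in> borel_measurable borel"
    and approx: "\<And>e. 0 < e \<Longrightarrow> \<exists>g. L2_continuous g \<and> nsq lborel (\<lambda>x. f x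
        - g x) \<le> ennreal e"
  shows "L2_continuous f"
proof -
  have "nsq lborel f < \<infinity>"
  proof -
    obtain g where g: "L2_continuous g" and le: "nsq lborel (\<lambda>x. f x - g x) \<le> ennreal 1"
      using approx[of 1] by auto
    note [measurable] = L2_continuousD(1)[OF g]
    have "nsq lborel f \<le> 2 * nsq lborel (\<lambda>x. f x - g x) + 2 * nsq lborel g"
      using nsq_add_le_2[of "\<lambda>x. f x - g x" lborel g] by simp
    also have "\<dots> < \<infinity>"
      using le_less_trans[OF le, of \<infinity>] L2_continuousD(2)[OF g]
      by (simp add: ennreal_mult_less_top)
    finally show ?thesis .
  qed
  moreover have "(\<lambda>n. nsq lborel (\<lambda>x. f (x + z n) - f x)) \<longlonglongrightarrow> 0" if z: "z
      \<longlonglongrightarrow> 0" for z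
  proof (rule order_tendstoI)
    fix e :: ennreal assume "0 < e"
    \<comment> \<open>e may be infinite; a value strictly below it is finite and hence a real
      number.\<close>
    obtain q where q: "0 < q" "q < e" using dense[OF \<open>0 < e\<close>] by blast
    define r where "r = enn2real q"
    have "q < \<infinity>" using q(2) top_greatest[of e] by (metis infinity_ennreal_def order_less_le_trans)
    then have qr: "q = ennreal r" by (simp add: r_def)
    have r: "0 < r" "ennreal r < e" using q by (auto simp: qr)
    \<comment> \<open>The final estimate is 2 (r/12) + 8 (r/12) = 5r/6, which stays below r.\<close>
    obtain g where g: "L2_continuous g" and le: "nsq lborel (\<lambda>x. f x - g x) \<le> ennreal (r / 12)"
      using approx[of "r / 12"] r by auto
    note [measurable] = L2_continuousD(1)[OF g]
    have *: "nsq lborel (\<lambda>x. f (x + z n) - f x) \<le>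
       2 * nsq lborel (\<lambda>x. g (x + z n) - g x) + 8 * nsq lborel (\<lambda>x. f x - g x)" for n
    proof -
      have "nsq lborel (\<lambda>x. f (x + z n) - f x) = nsq lborel (\<lambda>x. (g (x + z n) - g x) +
           ((f (x + z n) - g (x + z n)) - (f x - g x)))"
        by (simp add: algebra_simps)
      also have "\<dots> \<le> 2 * nsq lborel (\<lambda>x. g (x + z n) - g x) +
           2 * nsq lborel (\<lambda>x. (f (x + z n) - g (x + z n)) - (f x - g x))"
        by (rule nsq_add_le_2) auto
      also have "nsq lborel (\<lambda>x. (f (x + z n) - g (x + z n)) - (f x - g x)) \<le>
         2 * nsq lborel (\<lambda>x. f (x + z n) - g (x + z n)) + 2 * nsq lborel (\<lambda>x. f x - g x)"
        by (rule nsq_diff_le_2) auto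
      also have "nsq lborel (\<lambda>x. f (x + z n) - g (x + z n)) = nsq lborel (\<lambda>x. f x - g x)"
        by (rule nsq_lborel_translate[of "\<lambda>x. f x - g x"]) auto
      finally have "nsq lborel (\<lambda>x. f (x + z n) - f x) \<le> 2 * nsq lborel (\<lambda>x. g (x + z n) - g x) +
          2 * (2 * nsq lborel (\<lambda>x. f x - g x) + 2 * nsq lborel (\<lambda>x. f x - g x))"
        by (simp only: mult_left_mono add_left_mono zero_le)
      also have "2 * (2 * y + 2 * y) = 8 * y" for y :: ennreal
        by (simp add: distrib_left mult.assoc[symmetric] distrib_right[symmetric])
      finally show ?thesis .
    qed
    have "\<forall>\<^sub>F n in sequentially. nsq lborel (\<lambda>x. g (x + z n) - g x) < ennreal (r / 12)"
      using L2_continuousD(3)[OF g z] by (rule order_tendstoD) (use r in auto)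
    then show "\<forall>\<^sub>F n in sequentially. nsq lborel (\<lambda>x. f (x + z n) - f x) < e"
    proof eventually_elim
      case (elim n)
      have "nsq lborel (\<lambda>x. f (x + z n) - f x) \<le> 2 * ennreal (r / 12) + 8 * ennreal (r / 12)"
        by (rule order_trans[OF * add_mono]) (auto intro!: mult_left_mono le elim[THEN less_imp_le])
      also have "\<dots> = ennreal (2 * (r / 12) + 8 * (r / 12))"
        using r by (subst ennreal_plus) (auto simp: ennreal_mult simp del: times_divide_eq_right)
      also have "\<dots> \<le> ennreal r" using r by (intro ennreal_leI) auto
      finally show ?case using r by simp
    qed
  qed simp
  ultimately show ?thesis by (simp add: L2_continuous_def)
qed

text \<open>If x lies in U, then x + z n lies in U eventually, so the points lost by the shift
  disappear by dominated convergence. Pointwise convergence can fail for the points gained, at the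
  boundary of U, but they have the same measure as the points lost; hence the factor 2.\<close>

lemma L2_continuous_indicator_open:
  fixes U :: "'a::euclidean_space set" and c :: "'b::{real_normed_vector, second_countable_topology}"
  assumes U: "open U" and fin: "emeasure lborel U < \<infinity>"
  shows "L2_continuous (\<lambda>x. indicator U x *\<^sub>R c)"
proof -
  note [measurable] = borel_open[OF U]
  have fin2: "(\<integral>\<^sup>+ x. indicator U x * ennreal ((norm c)\<^sup>2) \<partial>lborel) < \<infinity>"
    using fin by (simp add: nn_integral_multc ennreal_mult_less_top)
  have 1: "nsq lborel (\<lambda>x. indicator U x *\<^sub>R c) < \<infinity>"
    unfolding nsq_def using fin2
    by (auto elim!: le_less_trans[rotated] intro!: nn_integral_mono split: split_indicator)
  have "(\<lambda>n. nsq lborel (\<lambda>x. indicator U (x + z n) *\<^sub>R c - indicator U x *\<^sub>R c))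
      \<longlonglongrightarrow> 0"
    if z: "z \<longlonglongrightarrow> 0" for z
  proof -
    let ?h = "\<lambda>n x. indicator U x * indicator (- U) (x + z n) * ennreal ((norm c)\<^sup>2)"
    have "(\<lambda>n. \<integral>\<^sup>+ x. ?h n x \<partial>lborel)
        \<longlonglongrightarrow> (\<integral>\<^sup>+ x. 0 \<partial>(lborel::'a measure))"
    proof (rule nn_integral_dominated_convergence[where w = "\<lambda>x. indicator U x * ennreal ((norm c)\<^sup>2)"])
      show "(\<integral>\<^sup>+ x. indicator U x * ennreal ((norm c)\<^sup>2) \<partial>lborel) < \<infinity>"
          by (rule fin2)
      have "(\<lambda>n. ?h n x) \<longlonglongrightarrow> 0" for x
      proof (cases "x \<in> U")
        case True
        have "(\<lambda>n. x + z n) \<longlonglongrightarrow> x" using tendsto_add[OF tendsto_const z, of x] by simp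
        then have "\<forall>\<^sub>F n in sequentially. x + z n \<in> U"
          using U True by (simp add: topological_tendstoD)
        then have "\<forall>\<^sub>F n in sequentially. ?h n x = 0" by eventually_elim simp
        then show ?thesis by (rule tendsto_eventually)
      qed simp
      then show "AE x in lborel. (\<lambda>n. ?h n x) \<longlonglongrightarrow> 0" by simp
    qed (auto split: split_indicator)
    then have lim: "(\<lambda>n. 2 * (\<integral>\<^sup>+ x. ?h n x \<partial>lborel)) \<longlonglongrightarrow> 0"
      using ennreal_tendsto_cmult[of 2 "\<lambda>n. \<integral>\<^sup>+ x. ?h n x \<partial>lborel" 0] by simp
    have "nsq lborel (\<lambda>x. indicator U (x + z n) *\<^sub>R c - indicator U x *\<^sub>R c)
       = 2 * (\<integral>\<^sup>+ x. ?h n x \<partial>lborel)" for n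
    proof -
      let ?k = "\<lambda>x. indicator (- U) x * indicator U (x + z n) * ennreal ((norm c)\<^sup>2)"
      have "nsq lborel (\<lambda>x. indicator U (x + z n) *\<^sub>R c - indicator U x *\<^sub>R c)
         = (\<integral>\<^sup>+ x. ?h n x + ?k x \<partial>lborel)"
        unfolding nsq_def by (intro nn_integral_cong) (auto split: split_indicator)
      also have "\<dots> = (\<integral>\<^sup>+ x. ?h n x \<partial>lborel) + (\<integral>\<^sup>+ x. ?k x \<partial>lborel)"
        by (rule nn_integral_add) auto
      also have "(\<integral>\<^sup>+ x. ?k x \<partial>lborel) = (\<integral>\<^sup>+ x. ?h n x \<partial>lborel)"
      proof -
        \<comment> \<open>Both sides equal |c|^2 (|U| - |U \<inter> (U - z)|).\<close>
        let ?m = "\<lambda>x. indicator U x * indicator U (x + z n) * ennreal ((norm c)\<^sup>2)"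
        have "(\<integral>\<^sup>+ x. ?m x \<partial>lborel) \<le> (\<integral>\<^sup>+ x. indicator U x
            * ennreal ((norm c)\<^sup>2) \<partial>lborel)"
          by (intro nn_integral_mono) (auto split: split_indicator)
        then have m: "(\<integral>\<^sup>+ x. ?m x \<partial>lborel) \<noteq> \<infinity>" using fin2 by auto
        have "(\<integral>\<^sup>+ x. ?m x \<partial>lborel) + (\<integral>\<^sup>+ x. ?k x \<partial>lborel)
           = (\<integral>\<^sup>+ x. indicator U (x + z n) * ennreal ((norm c)\<^sup>2) \<partial>lborel)"
          by (subst nn_integral_add[symmetric]) (auto intro!: nn_integral_cong split: split_indicator)
        also have "\<dots> = (\<integral>\<^sup>+ x. indicator U x * ennreal ((norm c)\<^sup>2) \<partial>lborel)"
          by (rule nn_integral_lborel_translate[of "\<lambda>x. indicator U x * ennreal ((norm c)\<^sup>2)"]) auto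
        also have "\<dots> = (\<integral>\<^sup>+ x. ?m x \<partial>lborel)
            + (\<integral>\<^sup>+ x. ?h n x \<partial>lborel)"
          by (subst nn_integral_add[symmetric]) (auto intro!: nn_integral_cong split: split_indicator)
        finally show ?thesis using m by (simp add: ennreal_add_left_cancel)
      qed
      finally show ?thesis by (simp add: mult_2)
    qed
    with lim show ?thesis by simp
  qed
  with 1 show ?thesis by (simp add: L2_continuous_def)
qed

text \<open>Outer regularity replaces S by an open superset of nearly the same measure.\<close>

lemma L2_continuous_indicator:
  fixes S :: "'a::euclidean_space set" and c :: "'b::{real_normed_vector, second_countable_topology}"
  assumes S[measurable]: "S \<in> sets borel" and fin: "emeasure lborel S < \<infinity>"
  shows "L2_continuous (\<lambda>x. indicator S x *\<^sub>R c)"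
proof (rule L2_continuous_approx)
  fix e :: real assume e: "0 < e"
  \<comment> \<open>The summand 1 keeps the denominator positive when c = 0.\<close>
  define d where "d = e / (1 + (norm c)\<^sup>2)"
  have pos: "0 < 1 + (norm c)\<^sup>2" by (simp add: add_pos_nonneg)
  have d: "0 < d" using e pos by (simp add: d_def)
  obtain U where U: "open U" "S \<subseteq> U" "emeasure lborel (U - S) < ennreal d"
    using outer_regular_lborel[OF S d] by auto
  note [measurable] = borel_open[OF U(1)]
  have "emeasure lborel U = emeasure lborel (U - S) + emeasure lborel S"
    using U by (subst plus_emeasure) (auto simp: Un_absorb2)
  then have "emeasure lborel U < \<infinity>" using U(3) fin by (auto simp: order_less_trans)
  then have "L2_continuous (\<lambda>x. indicator U x *\<^sub>R c)"
    by (rule L2_continuous_indicator_open[OF U(1)])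
  moreover have "nsq lborel (\<lambda>x. indicator S x *\<^sub>R c - indicator U x *\<^sub>R c) \<le> ennreal e"
  proof -
    have "nsq lborel (\<lambda>x. indicator S x *\<^sub>R c - indicator U x *\<^sub>R c)
      = (\<integral>\<^sup>+ x. indicator (U - S) x * ennreal ((norm c)\<^sup>2) \<partial>lborel)"
      unfolding nsq_def using U(2) by (intro nn_integral_cong) (auto split: split_indicator)
    also have "\<dots> = emeasure lborel (U - S) * ennreal ((norm c)\<^sup>2)"
      by (simp add: nn_integral_multc)
    also have "\<dots> \<le> ennreal d * ennreal ((norm c)\<^sup>2)"
      using U(3) by (intro mult_right_mono) auto
    also have "\<dots> = ennreal (d * (norm c)\<^sup>2)" using d by (simp add: ennreal_mult)
    also have "\<dots> \<le> ennreal (d * (1 + (norm c)\<^sup>2))"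
      using d by (intro ennreal_leI mult_left_mono) auto
    also have "d * (1 + (norm c)\<^sup>2) = e" using pos by (simp add: d_def)
    finally show ?thesis .
  qed
  ultimately show "\<exists>g. L2_continuous g \<and> nsq lborel (\<lambda>x. indicator S x *\<^sub>R c - g x)
      \<le> ennreal e"
    by blast
qed auto

lemma L2_continuous_simple:
  fixes s :: "'a::euclidean_space \<Rightarrow> 'b::{banach, second_countable_topology}"
  assumes s: "simple_function borel s" and fin: "nsq lborel s < \<infinity>"
  shows "L2_continuous s"
proof -
  have s_borel[measurable]: "s \<in> borel_measurable borel"
    using s by (rule borel_measurable_simple_function)
  have "L2_continuous (\<lambda>x. indicator (s -` {y}) x *\<^sub>R y)" if y: "y \<in> range s" for y
  \<comment> \<open>The level set of 0 may have infinite measure, but its term vanishes. For other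
    values Chebyshev's inequality bounds the measure of the level set.\<close>
  proof (cases "y = 0")
    case True
    then show ?thesis by (simp add: L2_continuous_zero)
  next
    case False
    have m[measurable]: "s -` {y} \<in> sets borel"
      using simple_functionD(2)[OF s, of "{y}"] by simp
    have "emeasure lborel (s -` {y}) * ennreal ((norm y)\<^sup>2)
       = (\<integral>\<^sup>+ x. indicator (s -` {y}) x * ennreal ((norm y)\<^sup>2) \<partial>lborel)"
      by (simp add: nn_integral_multc)
    also have "\<dots> \<le> nsq lborel s"
      unfolding nsq_def by (intro nn_integral_mono) (auto split: split_indicator)
    also have "\<dots> < \<infinity>" by (rule fin)
    finally have "emeasure lborel (s -` {y}) < \<infinity>"
      using False by (auto simp: ennreal_mult_less_top)
    then show ?thesis by (rule L2_continuous_indicator[OF m])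
  qed
  then have sum: "L2_continuous (\<lambda>x. \<Sum>y\<in>range s. indicator (s -` {y}) x *\<^sub>R y)"
    using simple_functionD(1)[OF s] by (intro L2_continuous_sum) auto
  have eq: "s = (\<lambda>x. \<Sum>y\<in>range s. indicator (s -` {y}) x *\<^sub>R y)"
    by (rule ext, rule simple_function_indicator_representation_banach
        [OF s, unfolded space_borel Int_UNIV_right, OF UNIV_I])
  show ?thesis by (subst eq) (rule sum)
qed

lemma L2_continuousI:
  fixes f :: "'a::euclidean_space \<Rightarrow> 'b::{banach, second_countable_topology}"
  assumes f[measurable]: "f \<in> borel_measurable borel" and fin: "nsq lborel f < \<infinity>"
  shows "L2_continuous f"
proof (rule L2_continuous_approx[OF f])
  fix e :: real assume e: "0 < e"
  obtain s where s: "\<And>i. simple_function borel (s i)" "\<And>x. (\<lambda>i. s i x) \<longlonglongrightarrow> f x"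
    "\<And>i x. norm (s i x) \<le> 2 * norm (f x)"
    using borel_measurable_implies_sequence_metric[OF f, of 0] by auto
  note [measurable] = borel_measurable_simple_function[OF s(1)]
  \<comment> \<open>Since |s i| \<le> 2 |f|, the error f - s i is at most 3 |f|, so 9 |f|^2
    dominates its square; the same function dominates |s i|^2.\<close>
  have fin': "(\<integral>\<^sup>+ x. ennreal (9 * (norm (f x))\<^sup>2) \<partial>lborel) < \<infinity>"
    using fin by (simp add: nsq_def ennreal_mult nn_integral_cmult ennreal_mult_less_top)
  have "(norm (s i x))\<^sup>2 \<le> 9 * (norm (f x))\<^sup>2" for i x
  proof -
    have "(norm (s i x))\<^sup>2 \<le> (3 * norm (f x))\<^sup>2"
      by (intro power_mono order_trans[OF s(3)]) auto
    then show ?thesis by (simp add: power_mult_distrib)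
  qed
  then have le: "nsq lborel (s i) \<le> (\<integral>\<^sup>+ x. ennreal (9 * (norm (f x))\<^sup>2) \<partial>lborel)" for i
    unfolding nsq_def by (intro nn_integral_mono ennreal_leI)
  have cont: "L2_continuous (s i)" for i
    by (rule L2_continuous_simple[OF s(1) le_less_trans[OF le fin']])
  have bd: "(norm (f x - s i x))\<^sup>2 \<le> 9 * (norm (f x))\<^sup>2" for i x
  proof -
    have "norm (f x - s i x) \<le> 3 * norm (f x)"
      using norm_triangle_ineq4[of "f x" "s i x"] s(3)[of i x] by linarith
    from power_mono[OF this, of 2] show ?thesis by (simp add: power_mult_distrib)
  qed
  have "(\<lambda>i. \<integral>\<^sup>+ x. ennreal ((norm (f x - s i x))\<^sup>2) \<partial>lborel)
      \<longlonglongrightarrow> (\<integral>\<^sup>+ x. 0 \<partial>(lborel::'a measure))"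
  proof (rule nn_integral_dominated_convergence[where w = "\<lambda>x. ennreal (9 * (norm (f x))\<^sup>2)"])
    have "(\<lambda>i. ennreal ((norm (f x - s i x))\<^sup>2)) \<longlonglongrightarrow> ennreal ((norm (f x
        - f x))\<^sup>2)" for x
      by (intro tendsto_intros s)
    then show "AE x in lborel. (\<lambda>i. ennreal ((norm (f x - s i x))\<^sup>2)) \<longlonglongrightarrow> 0" by simp
    show "AE x in lborel. ennreal ((norm (f x - s i x))\<^sup>2) \<le> ennreal (9 * (norm (f x))\<^sup>2)" for i
      using bd by (simp add: ennreal_leI)
  qed (use fin' in auto)
  then have "(\<lambda>i. nsq lborel (\<lambda>x. f x - s i x)) \<longlonglongrightarrow> 0" by (simp add: nsq_def)
  then have "\<forall>\<^sub>F i in sequentially. nsq lborel (\<lambda>x. f x - s i x) < ennreal e"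
    by (rule order_tendstoD) (use e in auto)
  then obtain i where "nsq lborel (\<lambda>x. f x - s i x) < ennreal e"
    by (auto simp: eventually_sequentially)
  then show "\<exists>g. L2_continuous g \<and> nsq lborel (\<lambda>x. f x - g x) \<le> ennreal e"
    using cont[of i] by (intro exI[of _ "s i"]) auto
qed


section \<open>The Gaussian and its Fourier transform\<close>

lemma integrable_std_gaussian: "integrable lborel (\<lambda>s::real. exp (- s\<^sup>2 / 2))"
proof -
  have "integrable lborel (\<lambda>s. sqrt (2 * pi) * std_normal_density s)"
    by (intro integrable_mult_right integrable_normal_density) simp
  then show ?thesis by (simp add: std_normal_density_def)
qed

lemma norm_cis_mult [simp]: "cmod (z * cis t) = cmod z" "cmod (cis t * z) = cmod z"
  by (simp_all add: norm_mult)

lemma borel_measurable_cis [measurable]: "cis \<in> borel_measurable borel"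
  by (intro borel_measurable_continuous_onI continuous_intros continuous_on_cis)

text \<open>This is the characteristic function of the standard normal distribution; sqrt (2 pi)
  undoes the normalisation of its density.\<close>

lemma integral_std_gaussian_cis:
  "(LINT s|lborel. complex_of_real (exp (- s\<^sup>2 / 2)) * cis (z * s))
     = complex_of_real (sqrt (2 * pi) * exp (- z\<^sup>2 / 2))"
proof -
  have "complex_of_real (exp (- z\<^sup>2 / 2)) = char std_normal_distribution z"
    by (simp add: char_std_normal_distribution)
  also have "\<dots> = (LINT s|lborel. std_normal_density s *\<^sub>R iexp (z * s))"
    unfolding char_def by (subst integral_density) auto
  also have "\<dots> = (LINT s|lborel. complex_of_real (1 / sqrt (2 * pi)) *
      (complex_of_real (exp (- s\<^sup>2 / 2)) * cis (z * s)))"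
    by (intro Bochner_Integration.integral_cong)
      (simp_all add: std_normal_density_def cis_conv_exp scaleR_conv_of_real mult.assoc)
  also have "\<dots> = complex_of_real (1 / sqrt (2 * pi)) *
      (LINT s|lborel. complex_of_real (exp (- s\<^sup>2 / 2)) * cis (z * s))"
    by (rule integral_mult_right_zero)
  finally show ?thesis by (simp add: field_simps)
qed

text \<open>With the factor 1/2 in the exponent the Gaussian is an eigenfunction of the Fourier
  transform, so no second kernel appears.\<close>

definition gauss :: "'a::euclidean_space \<Rightarrow> real"
  where "gauss x = exp (- (norm x)\<^sup>2 / 2)"

lemma gauss_pos: "0 < gauss x" and gauss_le_1: "gauss x \<le> 1"
  by (simp_all add: gauss_def)

lemma continuous_on_gauss: "continuous_on A gauss"
  unfolding gauss_def by (intro continuous_intros) simp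

lemma borel_measurable_gauss [measurable]: "gauss \<in> borel_measurable borel"
  by (intro borel_measurable_continuous_onI continuous_on_gauss)

interpretation lborel_Pi: product_sigma_finite "\<lambda>_. lborel :: real measure" ..

lemma gauss_sum_Basis:
  fixes f :: "'a::euclidean_space \<Rightarrow> real"
  shows "gauss (\<Sum>b\<in>Basis. f b *\<^sub>R b :: 'a) = (\<Prod>b\<in>(Basis :: 'a set). exp (- (f b)\<^sup>2 / 2))"
proof -
  have "(norm (\<Sum>b\<in>Basis. f b *\<^sub>R b :: 'a))\<^sup>2 = (\<Sum>b\<in>(Basis :: 'a set). (f b)\<^sup>2)"
    unfolding power2_norm_eq_inner
    by (subst euclidean_inner) (simp add: power2_eq_square)
  then show ?thesis
    by (simp add: gauss_def exp_sum[symmetric] sum_divide_distrib sum_negf)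
qed

text \<open>Gaussian and character both factor over an orthonormal basis, and \<open>lborel\<close>
  is the image of the product measure on coordinates; the integral becomes a product of
  one-dimensional ones.\<close>

lemma integral_gauss_cis:
  fixes z :: "'a::euclidean_space"
  shows "(LINT x|lborel. complex_of_real (gauss x) * cis (z \<bullet> x))
           = complex_of_real (sqrt (2 * pi) ^ DIM('a) * gauss z)"
    and "integrable lborel (gauss :: 'a \<Rightarrow> real)"
proof -
  have cis_sum: "cis (\<Sum>b\<in>Basis. (z \<bullet> b) * f b) = (\<Prod>b\<in>Basis. cis ((z \<bullet> b) * f b))" for f
    by (simp add: cis_conv_exp sum_distrib_left exp_sum)
  let ?g = "\<lambda>b s. complex_of_real (exp (- s\<^sup>2 / 2)) * cis ((z \<bullet> b) * s)"
  have int: "integrable lborel (?g b)" for b :: 'a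
    by (rule Bochner_Integration.integrable_bound[OF integrable_std_gaussian]) auto
  have "(LINT x|lborel. complex_of_real (gauss x) * cis (z \<bullet> x))
     = (LINT f|(\<Pi>\<^sub>M b\<in>(Basis::'a set). lborel).
          complex_of_real (gauss (\<Sum>b\<in>Basis. f b *\<^sub>R b :: 'a))
              * cis (z \<bullet> (\<Sum>b\<in>Basis. f b *\<^sub>R b)))"
    by (subst lborel_eq) (rule integral_distr; measurable)
  also have "\<dots> = (LINT f|(\<Pi>\<^sub>M b\<in>(Basis::'a set). lborel). (\<Prod>b\<in>(Basis::'a set). ?g b (f b)))"
    by (intro Bochner_Integration.integral_cong refl)
      (simp add: gauss_sum_Basis inner_sum_right mult.commute[of "_ :: real" "_ \<bullet> _"] cis_sum prod.distrib)
  also have "\<dots> = (\<Prod>b\<in>(Basis::'a set). LINT s|lborel. ?g b s)"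
    by (rule lborel_Pi.product_integral_prod) (use int in auto)
  also have "\<dots> = (\<Prod>b\<in>(Basis::'a set). complex_of_real (sqrt (2 * pi) * exp (- (z \<bullet> b)\<^sup>2 / 2)))"
    by (simp only: integral_std_gaussian_cis)
  also have "\<dots> = complex_of_real (sqrt (2 * pi) ^ DIM('a) * gauss (\<Sum>b\<in>Basis. (z \<bullet> b)
      *\<^sub>R b :: 'a))"
    unfolding gauss_sum_Basis by (simp add: prod.distrib)
  finally show "(LINT x|lborel. complex_of_real (gauss x) * cis (z \<bullet> x))
           = complex_of_real (sqrt (2 * pi) ^ DIM('a) * gauss z)"
    by (simp add: euclidean_representation)
  have "integrable (\<Pi>\<^sub>M b\<in>(Basis::'a set). lborel) (\<lambda>f. \<Prod>b\<in>(Basis::'a set). exp (- (f b :: real)\<^sup>2 / 2))"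
    by (rule lborel_Pi.product_integrable_prod) (use integrable_std_gaussian in auto)
  then show "integrable lborel (gauss :: 'a \<Rightarrow> real)"
    by (subst lborel_eq) (subst integrable_distr_eq; simp add: gauss_sum_Basis)
qed

lemma integral_gauss: "(LINT x|lborel. gauss (x::'a::euclidean_space)) = sqrt (2 * pi) ^ DIM('a)"
proof -
  have "complex_of_real (LINT x|lborel. gauss (x::'a)) = (LINT x|lborel. complex_of_real (gauss (x::'a))
      * cis (0 \<bullet> x))"
    by (simp add: integral_complex_of_real)
  then show ?thesis
    unfolding integral_gauss_cis by (simp add: gauss_def flip: of_real_power of_real_mult)
qed

lemma integral_lborel_scale:
  fixes f :: "'a::euclidean_space \<Rightarrow> 'b::{banach, second_countable_topology}"
  assumes [measurable]: "f \<in> borel_measurable borel" and c: "0 < c"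
  shows "(LINT x|lborel. f x) = c ^ DIM('a) *\<^sub>R (LINT x|lborel. f (c *\<^sub>R x))"
    and "integrable lborel (\<lambda>x. f (c *\<^sub>R x)) \<longleftrightarrow> integrable lborel f"
proof -
  have eq: "(lborel :: 'a measure) = density (distr lborel borel (\<lambda>x. c *\<^sub>R x)) (\<lambda>_. c ^ DIM('a))"
    using lborel_affine[of c "0::'a"] c by simp
  show "(LINT x|lborel. f x) = c ^ DIM('a) *\<^sub>R (LINT x|lborel. f (c *\<^sub>R x))"
    using c by (subst eq) (subst integral_density; simp add: integral_distr)
  have "integrable lborel f \<longleftrightarrow> integrable lborel (\<lambda>x. c ^ DIM('a) *\<^sub>R f (c *\<^sub>R x))"
    using c by (subst eq) (subst integrable_density; simp add: integrable_distr_eq)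
  then show "integrable lborel (\<lambda>x. f (c *\<^sub>R x)) \<longleftrightarrow> integrable lborel f"
    using c integrable_scaleR_right[of "inverse (c ^ DIM('a))" lborel "\<lambda>x. c ^ DIM('a) *\<^sub>R f (c *\<^sub>R x)"]
    by auto
qed


section \<open>The Plancherel inequality\<close>

lemma borel_measurable_cnj [measurable]: "cnj \<in> borel_measurable borel"
  by (intro borel_measurable_continuous_onI continuous_intros)

definition fourier :: "('a::euclidean_space \<Rightarrow> complex) \<Rightarrow> 'a \<Rightarrow> complex"
  where "fourier u w = (LINT x|lborel. u x * cis (- (w \<bullet> x)))"

lemma integrable_times_cis:
  assumes "integrable lborel u" and [measurable]: "g \<in> borel_measurable borel"
  shows "integrable lborel (\<lambda>x. u x * cis (g x))"
  by (rule Bochner_Integration.integrable_bound[OF assms(1)]) (use assms(1) in auto)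

lemma borel_measurable_fourier [measurable]:
  assumes [measurable]: "u \<in> borel_measurable borel"
  shows "fourier u \<in> borel_measurable borel"
proof -
  have "(\<lambda>w. LINT x|lborel. u x * cis (- (w \<bullet> x))) \<in> borel_measurable lborel"
    by (rule lborel.borel_measurable_lebesgue_integral) measurable
  then show ?thesis by (simp add: fourier_def[abs_def])
qed

lemma norm_fourier_le: "cmod (fourier u w) \<le> (LINT x|lborel. cmod (u x))"
  unfolding fourier_def by (rule order_trans[OF integral_norm_bound]) simp

lemma integrable_bounded_mult:
  fixes u v :: "'a::euclidean_space \<Rightarrow> complex"
  assumes u: "integrable lborel u" and [measurable]: "v \<in> borel_measurable borel"
    and "\<And>x. cmod (v x) \<le> B"
  shows "integrable lborel (\<lambda>x. v x * u x)"
  by (rule Bochner_Integration.integrable_bound[where f = "\<lambda>x. complex_of_real B * u x"])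
    (use assms in \<open>auto simp: norm_mult intro!: mult_right_mono AE_I2 intro: order_trans[OF _ abs_ge_self]\<close>)

text \<open>The kernel is symmetric in x and w and has modulus one, so |u x| |v w| dominates the
  double integral and Fubini applies.\<close>

lemma fourier_mult_swap:
  fixes u v :: "'a::euclidean_space \<Rightarrow> complex"
  assumes u: "integrable lborel u" and v: "integrable lborel v"
  shows "(LINT w|lborel. fourier u w * v w) = (LINT x|lborel. u x * fourier v x)"
proof -
  note [measurable] = borel_measurable_integrable[OF u] borel_measurable_integrable[OF v]
  let ?f = "\<lambda>x w. u x * cis (- (w \<bullet> x)) * v w"
  have "integrable (lborel \<Otimes>\<^sub>M lborel) (case_prod ?f)"
  proof (rule lborel_pair.Fubini_integrable)
    have "(\<lambda>x. LINT w|lborel. norm (case_prod ?f (x, w)))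
        = (\<lambda>x. cmod (u x) * (LINT w|lborel. cmod (v w)))"
      by (simp add: norm_mult)
    then show "integrable lborel (\<lambda>x. LINT w|lborel. norm (case_prod ?f (x, w)))"
      using u by simp
    have "integrable lborel (\<lambda>w. u x * (v w * cis (- (w \<bullet> x))))" for x
      by (intro integrable_mult_right integrable_times_cis v) measurable
    then show "AE x in lborel. integrable lborel (\<lambda>w. case_prod ?f (x, w))"
      by (simp add: mult_ac)
  qed measurable
  from lborel_pair.Fubini_integral[OF this]
  have "(LINT w|lborel. LINT x|lborel. ?f x w) = (LINT x|lborel. LINT w|lborel. ?f x w)" .
  also have "(LINT w|lborel. LINT x|lborel. ?f x w) = (LINT w|lborel. fourier u w * v w)"
    by (simp add: fourier_def)
  also have "(LINT x|lborel. LINT w|lborel. ?f x w) = (LINT x|lborel. u x * fourier v x)"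
    by (simp add: fourier_def mult.assoc mult.commute[of "cis _"] inner_commute)
  finally show ?thesis .
qed

text \<open>Modulation by x becomes translation by x, and dilation by c becomes dilation by 1/c with
  its Jacobian. As c tends to 0 the result concentrates at x: it is an approximate identity of total
  mass (2 pi)^n in dimension n.\<close>

lemma fourier_gauss_modulated:
  fixes x y :: "'a::euclidean_space"
  assumes c: "0 < c"
  shows "fourier (\<lambda>w. complex_of_real (gauss (c *\<^sub>R w)) * cis (w \<bullet> x)) y
    = complex_of_real (sqrt (2 * pi) ^ DIM('a) * gauss ((y - x) /\<^sub>R c) / c ^ DIM('a))"
proof -
  have "fourier (\<lambda>w. complex_of_real (gauss (c *\<^sub>R w)) * cis (w \<bullet> x)) y
     = (LINT w|lborel. complex_of_real (gauss (c *\<^sub>R w)) * cis (((x - y) /\<^sub>R c) \<bullet> (c *\<^sub>R w)))"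
    unfolding fourier_def using c
    by (intro Bochner_Integration.integral_cong refl)
      (simp add: mult.assoc cis_mult inner_diff_left inner_diff_right inner_commute
        flip: mult.assoc[of "inverse c"])
  \<comment> \<open>From here the calculation is about c^n times the transform; the factor is
    divided out at the end.\<close>
  also have "c ^ DIM('a) *\<^sub>R \<dots> = (LINT w|lborel. complex_of_real (gauss w) * cis (((x
      - y) /\<^sub>R c) \<bullet> w))"
    by (rule integral_lborel_scale(1)[OF _ c, symmetric]) measurable
  also have "\<dots> = complex_of_real (sqrt (2 * pi) ^ DIM('a) * gauss ((x - y) /\<^sub>R c))"
    by (rule integral_gauss_cis)
  also have "gauss ((x - y) /\<^sub>R c) = gauss ((y - x) /\<^sub>R c)"
    by (simp add: gauss_def norm_minus_commute)
  finally show ?thesis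
    using c by (simp add: field_simps scaleR_conv_of_real)
qed

section \<open>Gaussian regularisation and autocorrelation\<close>

lemma nsq_eq_integral:
  "integrable M (\<lambda>x. (norm (f x))\<^sup>2) \<Longrightarrow> nsq M f = ennreal (LINT x|M. (norm (f x))\<^sup>2)"
  unfolding nsq_def by (rule nn_integral_eq_integral) auto

lemma integrable_norm_square_iff:
  fixes f :: "'a \<Rightarrow> 'b::{real_normed_vector, second_countable_topology}"
  assumes [measurable]: "f \<in> borel_measurable M"
  shows "integrable M (\<lambda>x. (norm (f x))\<^sup>2) \<longleftrightarrow> nsq M f < \<infinity>"
  unfolding nsq_def integrable_iff_bounded by simp

lemma integrable_lborel_translate:
  fixes f :: "'a::euclidean_space \<Rightarrow> 'b::{banach, second_countable_topology}"
  assumes [measurable]: "f \<in> borel_measurable borel"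
  shows "integrable lborel (\<lambda>x. f (c + x)) \<longleftrightarrow> integrable lborel f"
    and "(LINT x|lborel. f (c + x)) = (LINT x|lborel. f x)"
proof -
  show "integrable lborel (\<lambda>x. f (c + x)) \<longleftrightarrow> integrable lborel f"
    by (subst (2) lborel_distr_plus[of c, symmetric]) (simp add: integrable_distr_eq)
  show "(LINT x|lborel. f (c + x)) = (LINT x|lborel. f x)"
    by (subst (2) lborel_distr_plus[of c, symmetric]) (simp add: integral_distr)
qed

text \<open>The multiplication formula moves the transform from u onto the damped conjugate
  transform \<open>?v\<close>, and transforming \<open>?v\<close> returns a Gaussian average of
  conjugated translates of u. The right side thus averages the autocorrelation of u over shifts of
  size about c.\<close>

lemma integral_gauss_fourier_square:
  fixes u :: "'a::euclidean_space \<Rightarrow> complex"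
  assumes u: "integrable lborel u" and c: "0 < c"
  shows "(LINT w|lborel. complex_of_real (gauss (c *\<^sub>R w)) * (fourier u w * cnj (fourier u w)))
    = complex_of_real (sqrt (2 * pi) ^ DIM('a)) *
      (LINT x|lborel. LINT z|lborel. complex_of_real (gauss z) * (u x * cnj (u (x + c *\<^sub>R z))))"
proof -
  note [measurable] = borel_measurable_integrable[OF u, simplified]
  have "integrable lborel (\<lambda>w::'a. gauss (c *\<^sub>R w))"
    by (simp add: integral_lborel_scale(2)[OF borel_measurable_gauss c] integral_gauss_cis(2))
  then have intg: "integrable lborel (\<lambda>w::'a. complex_of_real (gauss (c *\<^sub>R w)))"
    by (rule integrable_of_real)
  let ?v = "\<lambda>w. complex_of_real (gauss (c *\<^sub>R w)) * cnj (fourier u w)"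
  have v: "integrable lborel ?v"
    using integrable_bounded_mult[OF intg, of "\<lambda>w. cnj (fourier u w)" "LINT x|lborel. cmod (u x)"]
    by (simp add: norm_fourier_le mult.commute)
  have fv: "fourier ?v x = complex_of_real (sqrt (2 * pi) ^ DIM('a)) *
     (LINT z|lborel. complex_of_real (gauss z) * cnj (u (x + c *\<^sub>R z)))" for x
  proof -
    \<comment> \<open>Conjugating turns \<open>?v\<close> back into the transform of u times a
      modulated Gaussian, so the multiplication formula applies a second time.\<close>
    have "cnj (fourier ?v x) = (LINT w|lborel. cnj (?v w * cis (- (x \<bullet> w))))"
      unfolding fourier_def[of ?v] by (rule Bochner_Integration.integral_cnj[symmetric])
    also have "\<dots> = (LINT w|lborel. fourier u w * (complex_of_real (gauss (c *\<^sub>R w)) * cis (w \<bullet> x)))"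
      by (intro Bochner_Integration.integral_cong refl) (simp add: cis_cnj inner_commute mult_ac)
    also have "\<dots> = (LINT y|lborel. u y * fourier (\<lambda>w. complex_of_real (gauss (c *\<^sub>R w))
        * cis (w \<bullet> x)) y)"
      by (intro fourier_mult_swap u integrable_times_cis intg) measurable
    also have "\<dots> = (LINT y|lborel. u (x + y) * complex_of_real (sqrt (2 * pi) ^ DIM('a)
        * gauss (y /\<^sub>R c) / c ^ DIM('a)))"
      unfolding fourier_gauss_modulated[OF c]
      by (subst integrable_lborel_translate(2)[of _ x, symmetric]) (auto simp: algebra_simps)
    also have "\<dots> = c ^ DIM('a) *\<^sub>R (LINT z|lborel. u (x + c *\<^sub>R z) *
        complex_of_real (sqrt (2 * pi) ^ DIM('a) * gauss ((c *\<^sub>R z) /\<^sub>R c) / c ^ DIM('a)))"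
      by (rule integral_lborel_scale(1)[OF _ c]) measurable
    also have "\<dots> = (LINT z|lborel. complex_of_real (sqrt (2 * pi) ^ DIM('a)) *
        (complex_of_real (gauss z) * u (x + c *\<^sub>R z)))"
      unfolding integral_scaleR_right[symmetric]
      using c by (intro Bochner_Integration.integral_cong refl) (simp add: scaleR_conv_of_real)
    also have "\<dots> = complex_of_real (sqrt (2 * pi) ^ DIM('a)) *
        (LINT z|lborel. complex_of_real (gauss z) * u (x + c *\<^sub>R z))"
      by (rule integral_mult_right_zero)
    finally have "cnj (cnj (fourier ?v x)) = cnj (complex_of_real (sqrt (2 * pi) ^ DIM('a)) *
        (LINT z|lborel. complex_of_real (gauss z) * u (x + c *\<^sub>R z)))" by (rule arg_cong)
    then show ?thesis by (simp add: Bochner_Integration.integral_cnj[symmetric] del: Bochner_Integration.integral_cnj)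
  qed
  have "(LINT w|lborel. complex_of_real (gauss (c *\<^sub>R w)) * (fourier u w * cnj (fourier u w)))
     = (LINT w|lborel. fourier u w * ?v w)"
    by (simp add: mult_ac)
  also have "\<dots> = (LINT x|lborel. u x * fourier ?v x)"
    by (rule fourier_mult_swap[OF u v])
  also have "\<dots> = (LINT x|lborel. complex_of_real (sqrt (2 * pi) ^ DIM('a)) *
      (LINT z|lborel. complex_of_real (gauss z) * (u x * cnj (u (x + c *\<^sub>R z)))))"
    unfolding fv by (intro Bochner_Integration.integral_cong refl)
      (simp add: integral_mult_right_zero[symmetric] mult_ac del: integral_mult_right_zero)
  also have "\<dots> = complex_of_real (sqrt (2 * pi) ^ DIM('a)) *
      (LINT x|lborel. LINT z|lborel. complex_of_real (gauss z) * (u x * cnj (u (x + c *\<^sub>R z))))"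
    by (rule integral_mult_right_zero)
  finally show ?thesis .
qed

lemma mult_le_sum_squares:
  fixes a b :: real
  assumes "0 \<le> a" "0 \<le> b"
  shows "a * b \<le> a\<^sup>2 + b\<^sup>2"
  using sum_squares_bound[of a b] mult_nonneg_nonneg[OF assms] by linarith

text \<open>After bounding the product of moduli by the sum of squares, integrate over x first: by
  translation invariance every z contributes the same finite amount, and the Gaussian makes the z
  integral finite.\<close>

lemma integrable_autocorrelation:
  fixes u :: "'a::euclidean_space \<Rightarrow> complex"
  assumes [measurable]: "u \<in> borel_measurable borel" and u2: "integrable lborel (\<lambda>x. (cmod (u x))\<^sup>2)"
  shows "integrable (lborel \<Otimes>\<^sub>M lborel)
    (\<lambda>(x, z). complex_of_real (gauss z) * (u x * cnj (u (x + c *\<^sub>R z))))"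
proof (rule integrableI_bounded)
  let ?N = "nsq lborel u"
  have N: "?N < \<infinity>" using u2 by (simp add: integrable_norm_square_iff)
  have "(\<integral>\<^sup>+ p. ennreal (norm (case p of (x, z) \<Rightarrow> complex_of_real (gauss z) * (u x
      * cnj (u (x + c *\<^sub>R z)))))
      \<partial>(lborel \<Otimes>\<^sub>M lborel))
    \<le> (\<integral>\<^sup>+ (x, z). ennreal (gauss z) * (ennreal ((cmod (u x))\<^sup>2) + ennreal ((cmod (u (x + c
        *\<^sub>R z)))\<^sup>2))
      \<partial>(lborel \<Otimes>\<^sub>M lborel))"
  proof (intro nn_integral_mono, clarify)
    fix x z
    have "cmod (u x) * cmod (u (x + c *\<^sub>R z)) \<le> (cmod (u x))\<^sup>2 + (cmod (u (x + c *\<^sub>R z)))\<^sup>2"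
      by (intro mult_le_sum_squares norm_ge_zero)
    then have "gauss z * (cmod (u x) * cmod (u (x + c *\<^sub>R z)))
        \<le> gauss z * ((cmod (u x))\<^sup>2 + (cmod (u (x + c *\<^sub>R z)))\<^sup>2)"
      by (intro mult_left_mono) (auto simp: gauss_pos less_imp_le)
    then show "ennreal (norm (complex_of_real (gauss z) * (u x * cnj (u (x + c *\<^sub>R z)))))
      \<le> ennreal (gauss z) * (ennreal ((cmod (u x))\<^sup>2) + ennreal ((cmod (u (x + c *\<^sub>R z)))\<^sup>2))"
      using gauss_pos[of z]
      by (simp add: norm_mult ennreal_leI flip: ennreal_plus ennreal_mult)
  qed
  also have "\<dots> = (\<integral>\<^sup>+ z. \<integral>\<^sup>+ x. ennreal (gauss z) * (ennreal ((cmod (u x))\<^sup>2)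
      + ennreal ((cmod (u (x + c *\<^sub>R z)))\<^sup>2)) \<partial>lborel \<partial>lborel)"
    by (subst lborel_pair.nn_integral_snd[symmetric]) auto
  also have "\<dots> = (\<integral>\<^sup>+ z. ennreal (gauss z) * (2 * ?N) \<partial>(lborel :: 'a measure))"
  proof (rule nn_integral_cong)
    fix z :: 'a
    have "(\<integral>\<^sup>+ x. ennreal ((cmod (u (x + c *\<^sub>R z)))\<^sup>2) \<partial>lborel) = ?N"
      using nsq_lborel_translate[of u "c *\<^sub>R z"] by (simp add: nsq_def)
    then show "(\<integral>\<^sup>+ x. ennreal (gauss z) * (ennreal ((cmod (u x))\<^sup>2)
      + ennreal ((cmod (u (x + c *\<^sub>R z)))\<^sup>2)) \<partial>lborel) = ennreal (gauss z) * (2 * ?N)"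
      by (simp add: nn_integral_cmult nn_integral_add nsq_def[symmetric] mult_2)
  qed
  also have "\<dots> = (\<integral>\<^sup>+ z. ennreal (gauss z) \<partial>(lborel :: 'a measure)) * (2 * ?N)"
    by (rule nn_integral_multc) auto
  also have "(\<integral>\<^sup>+ z. ennreal (gauss z) \<partial>(lborel :: 'a measure))
      = ennreal (LINT z|lborel. gauss (z :: 'a))"
    by (rule nn_integral_eq_integral) (auto simp: gauss_pos less_imp_le integral_gauss_cis)
  also have "\<dots> * (2 * ?N) < \<infinity>"
    using N by (simp add: ennreal_mult_less_top)
  finally show "(\<integral>\<^sup>+ p. ennreal (norm (case p of (x, z) \<Rightarrow> complex_of_real (gauss z) * (u x
      * cnj (u (x + c *\<^sub>R z)))))
      \<partial>(lborel \<Otimes>\<^sub>M lborel)) < \<infinity>" .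
qed measurable

text \<open>Polarisation: 2 Re (p * cnj q) = |p|^2 + |q|^2 - |p - q|^2. The loss against the full
  norm is the translation difference, which is small for small z by L2 continuity; its crude bound
  by four times the norm provides the domination later.\<close>

lemma Re_autocorrelation:
  fixes u :: "'a::euclidean_space \<Rightarrow> complex"
  assumes [measurable]: "u \<in> borel_measurable borel" and u2: "integrable lborel (\<lambda>x. (cmod (u x))\<^sup>2)"
  shows "Re (LINT x|lborel. u x * cnj (u (x + z))) = (LINT x|lborel. (cmod (u x))\<^sup>2)
      - (LINT x|lborel. (cmod (u (x + z) - u x))\<^sup>2) / 2"
    and "0 \<le> (LINT x|lborel. (cmod (u (x + z) - u x))\<^sup>2)"
    and "(LINT x|lborel. (cmod (u (x + z) - u x))\<^sup>2) \<le> 4 * (LINT x|lborel. (cmod (u x))\<^sup>2)"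
    and "nsq lborel (\<lambda>x. u (x + z) - u x) = ennreal (LINT x|lborel. (cmod (u (x + z) - u x))\<^sup>2)"
proof -
  have u2': "integrable lborel (\<lambda>x. (cmod (u (x + z)))\<^sup>2)"
    and eq: "(LINT x|lborel. (cmod (u (x + z)))\<^sup>2) = (LINT x|lborel. (cmod (u x))\<^sup>2)"
    using integrable_lborel_translate[of "\<lambda>x. (cmod (u x))\<^sup>2" z] u2 by (simp_all add: add.commute)
  have le: "(cmod (u (x + z) - u x))\<^sup>2 \<le> 2 * (cmod (u (x + z)))\<^sup>2 + 2 * (cmod (u x))\<^sup>2" for x
    using norm_add_square_le[of 1 "u (x + z)" "- u x"] by simp
  have d2: "integrable lborel (\<lambda>x. (cmod (u (x + z) - u x))\<^sup>2)"
    by (rule Bochner_Integration.integrable_bound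
        [where f = "\<lambda>x. 2 * (cmod (u (x + z)))\<^sup>2 + 2 * (cmod (u x))\<^sup>2"])
      (use u2 u2' le in auto)
  have le': "cmod (u x * cnj (u (x + z))) \<le> (cmod (u x))\<^sup>2 + (cmod (u (x + z)))\<^sup>2" for x
    using mult_le_sum_squares[of "cmod (u x)" "cmod (u (x + z))"] by (simp add: norm_mult)
  have "integrable lborel (\<lambda>x. u x * cnj (u (x + z)))"
    by (rule Bochner_Integration.integrable_bound
        [where f = "\<lambda>x. (cmod (u x))\<^sup>2 + (cmod (u (x + z)))\<^sup>2"])
      (use u2 u2' le' in auto)
  then have "Re (LINT x|lborel. u x * cnj (u (x + z))) = (LINT x|lborel. Re (u x * cnj (u (x + z))))"
    by (rule integral_Re[symmetric])
  also have "\<dots> = (LINT x|lborel. ((cmod (u x))\<^sup>2 + (cmod (u (x + z)))\<^sup>2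
      - (cmod (u (x + z) - u x))\<^sup>2) / 2)"
    by (intro Bochner_Integration.integral_cong refl)
      (simp only: cmod_power2, simp add: power2_eq_square algebra_simps)
  also have "\<dots> = (LINT x|lborel. (cmod (u x))\<^sup>2)
      - (LINT x|lborel. (cmod (u (x + z) - u x))\<^sup>2) / 2"
    using u2 u2' d2 eq by simp
  finally show "Re (LINT x|lborel. u x * cnj (u (x + z))) = (LINT x|lborel. (cmod (u x))\<^sup>2)
      - (LINT x|lborel. (cmod (u (x + z) - u x))\<^sup>2) / 2" .
  show "0 \<le> (LINT x|lborel. (cmod (u (x + z) - u x))\<^sup>2)" by simp
  have "(LINT x|lborel. (cmod (u (x + z) - u x))\<^sup>2)
      \<le> (LINT x|lborel. 2 * (cmod (u (x + z)))\<^sup>2 + 2 * (cmod (u x))\<^sup>2)"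
    using u2 u2' d2 le by (intro integral_mono) auto
  also have "\<dots> = 4 * (LINT x|lborel. (cmod (u x))\<^sup>2)"
    using u2 u2' eq by simp
  finally show "(LINT x|lborel. (cmod (u (x + z) - u x))\<^sup>2) \<le> 4 * (LINT x|lborel. (cmod (u x))\<^sup>2)" .
  show "nsq lborel (\<lambda>x. u (x + z) - u x) = ennreal (LINT x|lborel. (cmod (u (x + z) - u x))\<^sup>2)"
    by (rule nsq_eq_integral[OF d2])
qed

text \<open>Since \<open>gauss\<close> is at most 1, every damped integral lies below the norm of
  the transform. As c tends to 0, the shifts c z in the autocorrelation vanish, and dominated
  convergence identifies the limit of the damped integrals.\<close>

lemma plancherel_le:
  fixes u :: "'a::euclidean_space \<Rightarrow> complex"
  assumes u: "integrable lborel u" and u2: "nsq lborel u < \<infinity>"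
  shows "ennreal ((2 * pi) ^ DIM('a)) * nsq lborel u \<le> nsq lborel (fourier u)"
proof -
  note [measurable] = borel_measurable_integrable[OF u, simplified]
  have int2: "integrable lborel (\<lambda>x. (cmod (u x))\<^sup>2)"
    using u2 by (simp add: integrable_norm_square_iff)
  define N where "N = (LINT x|lborel. (cmod (u x))\<^sup>2)"
  define D where "D z = (LINT x|lborel. (cmod (u (x + z) - u x))\<^sup>2)" for z
  \<comment> \<open>K enters twice, as the factor in the transform of the Gaussian and as its total
    mass; K * K is the Plancherel constant.\<close>
  define K :: real where "K = sqrt (2 * pi) ^ DIM('a)"
  note corr = Re_autocorrelation[OF _ int2, folded N_def D_def, simplified]
  have [measurable]: "D \<in> borel_measurable borel"
  proof -
    have "D \<in> borel_measurable lborel"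
      unfolding D_def[abs_def] by (rule lborel.borel_measurable_lebesgue_integral) measurable
    then show ?thesis by simp
  qed
  have N0: "0 \<le> N" by (simp add: N_def)
  have le: "ennreal (K * (LINT z|lborel. gauss z * (N - D (c *\<^sub>R z) / 2))) \<le> nsq lborel (fourier u)"
    if c: "0 < c" for c
  proof -
    let ?I = "LINT w|lborel. gauss (c *\<^sub>R w) * (cmod (fourier u w))\<^sup>2"
    let ?A = "LINT x|lborel. LINT z|lborel. complex_of_real (gauss z) * (u x * cnj (u (x + c *\<^sub>R z)))"
    have "complex_of_real ?I
       = (LINT w|lborel. complex_of_real (gauss (c *\<^sub>R w)) * (fourier u w * cnj (fourier u w)))"
      unfolding integral_complex_of_real[symmetric]
      by (intro Bochner_Integration.integral_cong refl) (simp add: complex_norm_square[symmetric])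
    also have "\<dots> = complex_of_real K * ?A"
      unfolding K_def by (rule integral_gauss_fourier_square[OF u c])
    finally have "Re (complex_of_real ?I) = Re (complex_of_real K * ?A)" by (rule arg_cong)
    then have I: "?I = K * Re ?A"
      by (simp only: times_complex.sel Re_complex_of_real Im_complex_of_real mult_zero_left diff_zero)
    have "?A = (LINT z|lborel. LINT x|lborel. complex_of_real (gauss z) * (u x * cnj (u (x + c *\<^sub>R z))))"
      using lborel_pair.Fubini_integral[OF integrable_autocorrelation[OF _ int2, of c]] by simp
    moreover have "integrable lborel
        (\<lambda>z. LINT x|lborel. complex_of_real (gauss z) * (u x * cnj (u (x + c *\<^sub>R z))))"
      using lborel_pair.integrable_snd[OF integrable_autocorrelation[OF _ int2, of c]] by simp
    ultimately have "Re ?A = (LINT z|lborel.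
        Re (LINT x|lborel. complex_of_real (gauss z) * (u x * cnj (u (x + c *\<^sub>R z)))))"
      by (simp only: integral_Re)
    also have "\<dots> = (LINT z|lborel. gauss z * (N - D (c *\<^sub>R z) / 2))"
      by (simp add: corr)
    finally have A: "Re ?A = (LINT z|lborel. gauss z * (N - D (c *\<^sub>R z) / 2))" .
    have intg: "integrable lborel (\<lambda>w::'a. gauss (c *\<^sub>R w))"
      by (simp add: integral_lborel_scale(2)[OF borel_measurable_gauss c] integral_gauss_cis(2))
    have "(cmod (fourier u w))\<^sup>2 \<le> (LINT x|lborel. cmod (u x))\<^sup>2" for w
      by (intro power_mono norm_fourier_le) simp
    then have "integrable lborel (\<lambda>w. gauss (c *\<^sub>R w) * (cmod (fourier u w))\<^sup>2)"
      by (intro Bochner_Integration.integrable_bound[OF integrable_mult_left[OF intg,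
            of "(LINT x|lborel. cmod (u x))\<^sup>2"]])
        (auto simp: abs_mult gauss_pos less_imp_le intro!: mult_left_mono)
    then have "ennreal ?I = (\<integral>\<^sup>+ w. ennreal (gauss (c *\<^sub>R w)
        * (cmod (fourier u w))\<^sup>2) \<partial>lborel)"
      by (intro nn_integral_eq_integral[symmetric]) (auto simp: gauss_pos less_imp_le)
    also have "\<dots> \<le> nsq lborel (fourier u)"
      unfolding nsq_def
      by (intro nn_integral_mono ennreal_leI mult_left_le_one_le) (auto simp: gauss_pos less_imp_le gauss_le_1)
    finally show ?thesis using I A by simp
  qed
  have cz: "(\<lambda>n. (1 / real (Suc n)) *\<^sub>R z) \<longlonglongrightarrow> 0" for z :: 'a
    using tendsto_scaleR[OF LIMSEQ_Suc[OF lim_1_over_n] tendsto_const[of z]] by simp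
  have D0: "(\<lambda>n. D ((1 / real (Suc n)) *\<^sub>R z)) \<longlonglongrightarrow> 0" for z
  proof -
    have "(\<lambda>n. ennreal (D ((1 / real (Suc n)) *\<^sub>R z))) \<longlonglongrightarrow> ennreal 0"
      using L2_continuousD(3)[OF L2_continuousI[OF _ u2] cz[of z]] by (simp add: corr)
    then show ?thesis by (rule tendsto_ennrealD) (auto simp: corr)
  qed
  have "(\<lambda>n. LINT z|lborel. gauss z * (N - D ((1 / real (Suc n)) *\<^sub>R z) / 2))
      \<longlonglongrightarrow> (LINT z|lborel. gauss (z::'a) * N)"
  proof (rule integral_dominated_convergence[where w = "\<lambda>z. gauss z * N"])
    \<comment> \<open>From 0 \<le> D z \<le> 4 N the bracket lies between -N and N.\<close>
    have "\<bar>N - D z / 2\<bar> \<le> N" for z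
      using corr(2,3)[of z] by (simp add: abs_le_iff)
    then show "AE z in lborel. norm (gauss z * (N - D ((1 / real (Suc n)) *\<^sub>R z) / 2)) \<le> gauss z * N" for n
      by (auto simp: abs_mult gauss_pos less_imp_le intro!: mult_left_mono)
    have "(\<lambda>n. gauss z * (N - D ((1 / real (Suc n)) *\<^sub>R z) / 2)) \<longlonglongrightarrow> gauss z * (N
        - 0 / 2)" for z
      by (intro tendsto_intros D0) simp
    then show "AE z in lborel. (\<lambda>n. gauss z * (N - D ((1 / real (Suc n)) *\<^sub>R z) / 2))
        \<longlonglongrightarrow> gauss z * N"
      by simp
  qed (auto simp: integral_gauss_cis)
  then have "(\<lambda>n. ennreal (K * (LINT z|lborel. gauss z * (N - D ((1 / real (Suc n)) *\<^sub>R z) / 2))))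
      \<longlonglongrightarrow> ennreal (K * (LINT z|lborel. gauss (z::'a) * N))"
    by (intro tendsto_intros)
  then have "ennreal (K * (LINT z|lborel. gauss (z::'a) * N)) \<le> nsq lborel (fourier u)"
    by (rule LIMSEQ_le_const2) (intro exI allI impI le, simp)
  also have "K * (LINT z|lborel. gauss (z::'a) * N) = K * K * N"
    by (simp add: integral_gauss K_def)
  also have "K * K = (2 * pi) ^ DIM('a)"
    unfolding K_def power_mult_distrib[symmetric] by simp
  finally show ?thesis
    using N0 nsq_eq_integral[OF int2] by (simp add: N_def ennreal_mult)
qed

text \<open>Comparing p with P n and Q n with q costs a factor 1 + d each time, plus errors that
  vanish as n grows. Taking n to infinity first and then d to 0 preserves K exactly. If the right
  side is infinite nothing is to be shown.\<close>

lemma nsq_limit_le: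
  fixes p :: "'a \<Rightarrow> 'b::{real_normed_vector, second_countable_topology}"
    and q :: "'c \<Rightarrow> 'd::{real_normed_vector, second_countable_topology}"
  assumes [measurable]: "p \<in> borel_measurable M" "\<And>n. P n \<in> borel_measurable M"
    "q \<in> borel_measurable N" "\<And>n. Q n \<in> borel_measurable N"
    and P: "(\<lambda>n. nsq M (\<lambda>x. P n x - p x)) \<longlonglongrightarrow> 0"
    and Q: "(\<lambda>n. nsq N (\<lambda>x. Q n x - q x)) \<longlonglongrightarrow> 0"
    and le: "\<And>n. ennreal K * nsq M (P n) \<le> nsq N (Q n)"
  shows "ennreal K * nsq M p \<le> nsq N q"
proof (cases "nsq N q = \<infinity>")
  case False
  have bound: "ennreal K * nsq M p \<le> ennreal ((1 + d) * (1 + d)) * nsq N q" if d: "0 < d" for d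
  proof (rule LIMSEQ_le_const)
    let ?R = "\<lambda>n. ennreal (1 + d) * (ennreal (1 + d) * nsq N q + ennreal (1 + 1 / d)
        * nsq N (\<lambda>x. Q n x - q x))
       + ennreal K * (ennreal (1 + 1 / d) * nsq M (\<lambda>x. P n x - p x))"
    have "?R \<longlonglongrightarrow> ennreal (1 + d) * (ennreal (1 + d) * nsq N q + ennreal (1 + 1 / d) * 0)
       + ennreal K * (ennreal (1 + 1 / d) * 0)"
      by (intro tendsto_add tendsto_const ennreal_tendsto_cmult P Q ennreal_less_top)
    then show "?R \<longlonglongrightarrow> ennreal ((1 + d) * (1 + d)) * nsq N q"
      using d by (simp only: ennreal_mult mult.assoc mult_zero_right add_0_right)
    have "ennreal K * nsq M p \<le> ?R n" for n
    proof -
      have "nsq M p \<le> ennreal (1 + d) * nsq M (P n) + ennreal (1 + 1 / d) * nsq M (\<lambda>x. p x - P n x)"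
        using nsq_add_le[of "P n" M "\<lambda>x. p x - P n x" d] d by simp
      then have "ennreal K * nsq M p \<le> ennreal K *
          (ennreal (1 + d) * nsq M (P n) + ennreal (1 + 1 / d) * nsq M (\<lambda>x. P n x - p x))"
        by (subst nsq_minus_commute) (rule mult_left_mono, auto)
      also have "\<dots> = ennreal (1 + d) * (ennreal K * nsq M (P n)) +
          ennreal K * (ennreal (1 + 1 / d) * nsq M (\<lambda>x. P n x - p x))"
        by (simp only: distrib_left mult.left_commute)
      also have "ennreal K * nsq M (P n) \<le> nsq N (Q n)" by (rule le)
      also have "nsq N (Q n) \<le> ennreal (1 + d) * nsq N q + ennreal (1 + 1 / d) * nsq N (\<lambda>x. Q n x - q x)"
        using nsq_add_le[of q N "\<lambda>x. Q n x - q x" d] d by simp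
      finally show ?thesis by (simp only: mult_left_mono add_right_mono zero_le)
    qed
    then show "\<exists>N. \<forall>n\<ge>N. ennreal K * nsq M p \<le> ?R n" by blast
  qed
  have "(\<lambda>n. ennreal ((1 + 1 / real (Suc n)) * (1 + 1 / real (Suc n))) * nsq N q)
      \<longlonglongrightarrow> ennreal ((1 + 0) * (1 + 0)) * nsq N q"
    by (intro tendsto_mult_ennreal tendsto_ennrealI tendsto_intros LIMSEQ_Suc[OF lim_1_over_n]) (use False in auto)
  then have "(\<lambda>n. ennreal ((1 + 1 / real (Suc n)) * (1 + 1 / real (Suc n))) * nsq N q)
      \<longlonglongrightarrow> nsq N q"
    by simp
  then show ?thesis
    by (rule LIMSEQ_le_const) (intro exI allI impI bound, simp)
qed simp

section \<open>Transfer to the completed Lebesgue measure\<close>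

lemma distr_lebesgue_translate:
  fixes c :: "'a::euclidean_space"
  shows "distr lebesgue lebesgue (\<lambda>x. x + c) = lebesgue"
    and measurable_lebesgue_translate: "(\<lambda>x. x + c) \<in> lebesgue \<rightarrow>\<^sub>M lebesgue"
  using lebesgue_affine_euclidean[of "\<lambda>_. 1" c] lebesgue_affine_measurable[of "\<lambda>_. 1" c]
  by (simp_all add: euclidean_representation density_1 add.commute)

lemma borel_measurable_lebesgue_translate:
  fixes c :: "'a::euclidean_space"
  assumes "f \<in> borel_measurable lebesgue"
  shows "(\<lambda>x. f (x + c)) \<in> borel_measurable lebesgue"
  by (rule measurable_compose[OF measurable_lebesgue_translate assms])

lemma nn_integral_lebesgue_translate:
  fixes c :: "'a::euclidean_space"
  assumes "f \<in> borel_measurable lebesgue"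
  shows "(\<integral>\<^sup>+ x. f (x + c) \<partial>lebesgue) = (\<integral>\<^sup>+ x. f x \<partial>lebesgue)"
  using nn_integral_distr[OF measurable_lebesgue_translate[of c], of f] assms
  by (simp add: distr_lebesgue_translate)

lemma integral_lebesgue_translate:
  fixes c :: "'a::euclidean_space" and f :: "'a \<Rightarrow> 'b::{banach, second_countable_topology}"
  assumes "f \<in> borel_measurable lebesgue"
  shows "integrable lebesgue (\<lambda>x. f (x + c)) \<longleftrightarrow> integrable lebesgue f"
    and "(LINT x|lebesgue. f (x + c)) = (LINT x|lebesgue. f x)"
  using integrable_distr_eq[OF measurable_lebesgue_translate[of c] assms]
    integral_distr[OF measurable_lebesgue_translate[of c] assms]
  by (simp_all add: distr_lebesgue_translate)

lemma nsq_lebesgue_translate: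
  fixes c :: "'a::euclidean_space" and f :: "'a \<Rightarrow> 'b::{real_normed_vector, second_countable_topology}"
  assumes [measurable]: "f \<in> borel_measurable lebesgue"
  shows "nsq lebesgue (\<lambda>x. f (x + c)) = nsq lebesgue f"
  unfolding nsq_def by (rule nn_integral_lebesgue_translate[of "\<lambda>x. ennreal ((norm (f x))\<^sup>2)"]) measurable

text \<open>The Fubini arguments above live on products of \<open>lborel\<close>, so Lebesgue
  measurable functions enter them through a Borel version.\<close>

lemma lebesgue_complex_borel_version:
  fixes u :: "'a::euclidean_space \<Rightarrow> complex"
  assumes [measurable]: "u \<in> borel_measurable lebesgue"
  obtains u' where "u' \<in> borel_measurable borel" "AE x in lebesgue. u x = u' x"
proof -
  have "(\<lambda>x. Re (u x)) \<in> borel_measurable lebesgue" "(\<lambda>x. Im (u x)) \<in> borel_measurable lebesgue"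
    by measurable
  then obtain r i where [measurable]: "r \<in> borel_measurable lborel" "i \<in> borel_measurable lborel"
    and "AE x in lborel. Re (u x) = r x" "AE x in lborel. Im (u x) = i x"
    using completion_ex_borel_measurable_real by metis
  then have "AE x in lborel. u x = Complex (r x) (i x)"
    by (auto simp: complex_eq_iff)
  then have "AE x in lebesgue. u x = Complex (r x) (i x)"
    by (rule AE_completion)
  moreover have "(\<lambda>x. Complex (r x) (i x)) \<in> borel_measurable borel"
    by (simp add: Complex_eq)
  ultimately show ?thesis by (rule that[rotated])
qed

text \<open>Passing to a Borel version changes u on a null set only, so the integral is unchanged at
  every frequency, not merely at almost every one.\<close>

lemma lebesgue_fourier_plancherel_le:
  fixes u :: "'a::euclidean_space \<Rightarrow> complex"
  assumes u: "integrable lebesgue u"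
  shows "(\<lambda>w. LINT x|lebesgue. u x * cis (- (w \<bullet> x))) \<in> borel_measurable borel"
    and "nsq lebesgue u < \<infinity> \<Longrightarrow> ennreal ((2 * pi) ^ DIM('a)) * nsq lebesgue u
      \<le> nsq lebesgue (\<lambda>w. LINT x|lebesgue. u x * cis (- (w \<bullet> x)))"
proof -
  note [measurable] = borel_measurable_integrable[OF u]
  obtain u' where [measurable]: "u' \<in> borel_measurable borel" and ae: "AE x in lebesgue. u x = u' x"
    by (rule lebesgue_complex_borel_version[OF borel_measurable_integrable[OF u]])
  have [measurable]: "u' \<in> borel_measurable lebesgue"
    by (rule measurable_completion) simp
  have [measurable]: "(\<lambda>x. cis (- (w \<bullet> x))) \<in> borel_measurable lebesgue" for w :: 'a
    by (rule measurable_completion) simp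
  have "integrable lebesgue u'"
    using ae u by (subst integrable_cong_AE[symmetric, of u]) auto
  then have u': "integrable lborel u'"
    by (simp add: integrable_completion)
  have "(LINT x|lebesgue. u x * cis (- (w \<bullet> x))) = (LINT x|lebesgue. u' x * cis (- (w \<bullet> x)))" for w
    using ae by (intro integral_cong_AE) auto
  then have eq: "(\<lambda>w. LINT x|lebesgue. u x * cis (- (w \<bullet> x))) = fourier u'"
    by (simp add: fourier_def integral_completion fun_eq_iff)
  then show "(\<lambda>w. LINT x|lebesgue. u x * cis (- (w \<bullet> x))) \<in> borel_measurable borel"
    by simp
  have n: "nsq lebesgue u = nsq lborel u'"
  proof -
    have "nsq lebesgue u = nsq lebesgue u'"
      unfolding nsq_def by (rule nn_integral_cong_AE) (use ae in \<open>eventually_elim, simp\<close>)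
    then show ?thesis by (simp add: nsq_def nn_integral_completion)
  qed
  show "ennreal ((2 * pi) ^ DIM('a)) * nsq lebesgue u
      \<le> nsq lebesgue (\<lambda>w. LINT x|lebesgue. u x * cis (- (w \<bullet> x)))" if "nsq lebesgue u < \<infinity>"
    using plancherel_le[OF u'] that unfolding eq n by (simp add: nsq_def nn_integral_completion)
qed

text \<open>The weight vanishes only on a hyperplane, which is a null set. This rules out the
  products 0 * \<infinity> in the theorem.\<close>

lemma nsq_weighted_eq_0:
  fixes f :: "'a::euclidean_space \<Rightarrow> 'b::{real_normed_vector, second_countable_topology}"
  assumes [measurable]: "f \<in> borel_measurable lebesgue" and a: "a \<noteq> 0"
    and 0: "(\<integral>\<^sup>+ x. ennreal ((a \<bullet> x)\<^sup>2)
        * ennreal ((norm (f x))\<^sup>2) \<partial>lebesgue) = 0"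
  shows "nsq lebesgue f = 0"
proof -
  have [measurable]: "(\<lambda>x. ennreal ((a \<bullet> x)\<^sup>2)) \<in> borel_measurable lebesgue"
    by (intro measurable_completion) simp
  have "AE x in lebesgue. ennreal ((a \<bullet> x)\<^sup>2) * ennreal ((norm (f x))\<^sup>2) = 0"
    by (rule nn_integral_0_iff_AE[THEN iffD1, OF _ 0]) measurable
  moreover have "AE x in lebesgue. a \<bullet> x \<noteq> 0"
    using negligible_hyperplane[of a 0] a
    by (auto simp: negligible_iff_null_sets dest: AE_not_in)
  ultimately have "AE x in lebesgue. ennreal ((norm (f x))\<^sup>2) = 0"
    by eventually_elim auto
  then show ?thesis unfolding nsq_def by (subst nn_integral_0_iff_AE) measurable
qed


section \<open>The Clifford Fourier transform\<close>

lemma bounded_linear_g3_mult_right: "bounded_linear (\<lambda>M::g3. M * N)"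
  unfolding linear_conv_bounded_linear[symmetric]
  by (rule linearI) (simp_all add: distrib_right)

text \<open>Since \<open>e\<^sub>1 * i3 = e\<^sub>2 * e\<^sub>3\<close> and cyclically, right multiplication by \<open>i3\<close> acts on each of
  the four coordinate pairs below as multiplication by the imaginary unit.\<close>

definition g3_part :: "nat \<Rightarrow> g3 \<Rightarrow> complex"
  where "g3_part k M = [Complex (sc M) (c123 M), Complex (c1 M) (c23 M),
    Complex (c2 M) (c31 M), Complex (c3 M) (c12 M)] ! k"

lemma lessThan_4: "{..<4::nat} = {0, 1, 2, 3}"
  by auto

lemma bounded_linear_g3_part: "k < 4 \<Longrightarrow> bounded_linear (g3_part k)"
  unfolding linear_conv_bounded_linear[symmetric] lessThan_iff[symmetric] lessThan_4
  by (rule linearI) (auto simp: g3_part_def plus_g3_def scaleR_g3_def complex_eq_iff)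

lemma g3_part_mult_cis3: "k < 4 \<Longrightarrow> g3_part k (M * cis3 t) = g3_part k M * cis t"
  unfolding lessThan_iff[symmetric] lessThan_4
  by (auto simp: g3_part_def cis3_def g3_blades g3_vectors(1) plus_g3_def scaleR_g3_def times_g3_def
      complex_eq_iff)

lemma norm_g3_parts: "(norm M)\<^sup>2 = (\<Sum>k<4. (cmod (g3_part k M))\<^sup>2)"
  unfolding lessThan_4 by (simp add: g3_part_def norm_g3_def cmod_power2)

text \<open>The norm is not multiplicative in general, but this factor multiplies each complex
  coordinate by the same unimodular number.\<close>

lemma norm_mult_cis3: "norm (M * cis3 t) = norm M"
proof -
  have "(norm (M * cis3 t))\<^sup>2 = (norm M)\<^sup>2"
    unfolding norm_g3_parts by (intro sum.cong refl) (simp add: g3_part_mult_cis3)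
  then show ?thesis by simp
qed

lemma cis3_add: "cis3 (s + t) = cis3 s * cis3 t"
  by (simp add: cis3_def g3_blades g3_vectors(1) plus_g3_def scaleR_g3_def times_g3_def
      cos_add sin_add algebra_simps)

text \<open>In each complex coordinate this is |cis t - 1| = 2 |sin (t/2)|, the half-angle
  formula.\<close>

lemma norm_mult_cis3_minus_one: "norm (M * cis3 t - M) = norm ((2 * sin (t / 2)) *\<^sub>R M)"
proof -
  have cis: "(cmod (cis t - 1))\<^sup>2 = (2 * sin (t / 2))\<^sup>2"
    using cos_double_sin[of "t / 2"]
    by (simp add: cmod_power2 power2_diff power_mult_distrib sin_squared_eq)
  have "(norm (M * cis3 t - M))\<^sup>2 = (2 * sin (t / 2))\<^sup>2 * (norm M)\<^sup>2"
    unfolding norm_g3_parts sum_distrib_left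
  proof (intro sum.cong refl)
    fix k :: nat assume "k \<in> {..<4}"
    then have k: "k < 4" by simp
    then have "g3_part k (M * cis3 t - M) = g3_part k M * (cis t - 1)"
      using linear_diff[OF bounded_linear.linear[OF bounded_linear_g3_part[OF k]]]
      by (simp add: g3_part_mult_cis3 algebra_simps)
    then show "(cmod (g3_part k (M * cis3 t - M)))\<^sup>2 = (2 * sin (t / 2))\<^sup>2 * (cmod (g3_part k M))\<^sup>2"
      using cis by (simp add: norm_mult power_mult_distrib)
  qed
  then have "(norm (M * cis3 t - M))\<^sup>2 = (norm ((2 * sin (t / 2)) *\<^sub>R M))\<^sup>2"
    by (simp add: power_mult_distrib)
  then show ?thesis by (simp del: norm_scaleR)
qed

lemma borel_measurable_g3_part [measurable (raw)]:
  assumes "f \<in> borel_measurable M" "k < 4"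
  shows "(\<lambda>x. g3_part k (f x)) \<in> borel_measurable M"
  by (rule measurable_compose[OF assms(1)])
    (intro borel_measurable_continuous_onI linear_continuous_on bounded_linear_g3_part assms(2))

lemma g3_eq_sum_parts:
  "M = Re (g3_part 0 M) *\<^sub>R 1 + Re (g3_part 1 M) *\<^sub>R e\<^sub>1 + Re (g3_part 2 M) *\<^sub>R e\<^sub>2
    + Re (g3_part 3 M) *\<^sub>R e\<^sub>3 + Im (g3_part 3 M) *\<^sub>R (e\<^sub>1 * e\<^sub>2)
    + Im (g3_part 2 M) *\<^sub>R (e\<^sub>3 * e\<^sub>1) + Im (g3_part 1 M) *\<^sub>R (e\<^sub>2 * e\<^sub>3)
    + Im (g3_part 0 M) *\<^sub>R i3"
  by (subst g3_expansion[of M]) (simp add: g3_part_def)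

text \<open>A multivector is a fixed linear combination of blades in its complex coordinates.
  Measurability of products with \<open>cis3\<close> is reduced to complex multiplication in this
  way.\<close>

lemma borel_measurable_g3I:
  assumes "\<And>k. k < 4 \<Longrightarrow> (\<lambda>x. g3_part k (f x)) \<in> borel_measurable M"
  shows "f \<in> borel_measurable M"
proof -
  have [measurable]: "(\<lambda>x. g3_part 0 (f x)) \<in> borel_measurable M" "(\<lambda>x. g3_part 1 (f x))
      \<in> borel_measurable M"
    "(\<lambda>x. g3_part 2 (f x)) \<in> borel_measurable M" "(\<lambda>x. g3_part 3 (f x)) \<in> borel_measurable M"
    by (auto intro: assms)
  show ?thesis by (subst measurable_cong[OF g3_eq_sum_parts]) measurable
qed

lemma nsq_g3_parts:
  assumes [measurable]: "f \<in> borel_measurable M"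
  shows "nsq M f = (\<Sum>k<4. nsq M (\<lambda>x. g3_part k (f x)))"
proof -
  have "nsq M f = (\<integral>\<^sup>+ x. (\<Sum>k<4. ennreal ((cmod (g3_part k (f x)))\<^sup>2)) \<partial>M)"
    unfolding nsq_def norm_g3_parts by (intro nn_integral_cong) (simp add: sum_ennreal)
  also have "\<dots> = (\<Sum>k<4. nsq M (\<lambda>x. g3_part k (f x)))"
    unfolding nsq_def by (rule nn_integral_sum) simp
  finally show ?thesis .
qed

section \<open>The transform of integrable functions\<close>

lemma integrable_mult_cis3:
  assumes u: "integrable lebesgue u" and [measurable]: "g \<in> borel_measurable lebesgue"
  shows "integrable lebesgue (\<lambda>x. u x * cis3 (g x))"
proof (rule Bochner_Integration.integrable_bound[OF u])
  note [measurable] = borel_measurable_integrable[OF u]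
  have "(\<lambda>x. g3_part k (u x) * cis (g x)) \<in> borel_measurable lebesgue" if "k < 4" for k
    using that by measurable
  then show "(\<lambda>x. u x * cis3 (g x)) \<in> borel_measurable lebesgue"
    by (intro borel_measurable_g3I) (simp add: g3_part_mult_cis3)
qed (simp add: norm_mult_cis3)

lemma borel_measurable_lebesgue_inner [measurable]: "(\<lambda>x. a \<bullet> x) \<in> borel_measurable lebesgue"
  by (rule measurable_completion) simp

lemma g3_part_cft_integral:
  assumes u: "integrable lebesgue u" and k: "k < 4"
  shows "g3_part k (cft_integral u w) = (LINT x|lebesgue. g3_part k (u x) * cis (- (w \<bullet> x)))"
proof -
  have "integrable lebesgue (\<lambda>x. u x * cis3 (- (w \<bullet> x)))"
    by (intro integrable_mult_cis3 u) measurable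
  from integral_bounded_linear[OF bounded_linear_g3_part[OF k] this] show ?thesis
    using k by (simp add: cft_integral_def g3_part_mult_cis3)
qed

lemma borel_measurable_cft_integral:
  assumes u: "integrable lebesgue u"
  shows "cft_integral u \<in> borel_measurable lebesgue"
proof (rule borel_measurable_g3I)
  fix k :: nat assume k: "k < 4"
  have "(\<lambda>w. LINT x|lebesgue. g3_part k (u x) * cis (- (w \<bullet> x))) \<in> borel_measurable borel"
    by (rule lebesgue_fourier_plancherel_le(1)[OF integrable_bounded_linear[OF bounded_linear_g3_part[OF k] u]])
  then show "(\<lambda>w. g3_part k (cft_integral u w)) \<in> borel_measurable lebesgue"
    unfolding g3_part_cft_integral[OF u k] by (intro measurable_completion) simp
qed

text \<open>Squared norms add over the four complex coordinates, each of which satisfies the complex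
  inequality in dimension 3.\<close>

lemma cft_integral_plancherel_le:
  assumes u: "integrable lebesgue u" and u2: "nsq lebesgue u < \<infinity>"
  shows "ennreal ((2 * pi) ^ 3) * nsq lebesgue u \<le> nsq lebesgue (cft_integral u)"
proof -
  have [measurable]: "u \<in> borel_measurable lebesgue" by (rule borel_measurable_integrable[OF u])
  have "ennreal ((2 * pi) ^ 3) * nsq lebesgue (\<lambda>x. g3_part k (u x))
      \<le> nsq lebesgue (\<lambda>w. g3_part k (cft_integral u w))" if k: "k < 4" for k
  proof -
    have "nsq lebesgue (\<lambda>x. g3_part k (u x)) \<le> nsq lebesgue u"
      unfolding nsq_g3_parts[OF borel_measurable_integrable[OF u]]
      using k by (intro member_le_sum[of k "{..<4}" "\<lambda>k. nsq lebesgue (\<lambda>x. g3_part k (u x))"]) auto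
    then have "nsq lebesgue (\<lambda>x. g3_part k (u x)) < \<infinity>" using u2 by (rule le_less_trans)
    from lebesgue_fourier_plancherel_le(2)[OF integrable_bounded_linear[OF bounded_linear_g3_part[OF k] u] this]
    show ?thesis by (simp add: g3_part_cft_integral[OF u k])
  qed
  then show ?thesis
    unfolding nsq_g3_parts[OF borel_measurable_integrable[OF u]]
      nsq_g3_parts[OF borel_measurable_cft_integral[OF u]] sum_distrib_left
    by (intro sum_mono) simp
qed

text \<open>The phase splits off on the right of the integrand and leaves the integral by linearity
  of right multiplication; its sign is positive because x is x + c shifted back by c.\<close>

lemma cft_integral_translate:
  assumes u: "integrable lebesgue u"
  shows "cft_integral (\<lambda>x. u (x + c)) w = cft_integral u w * cis3 (w \<bullet> c)"
proof -
  have int: "integrable lebesgue (\<lambda>x. u x * cis3 (- (w \<bullet> x)))"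
    by (intro integrable_mult_cis3 u) measurable
  have "cft_integral (\<lambda>x. u (x + c)) w
      = (LINT x|lebesgue. u (x + c) * cis3 (- (w \<bullet> (x + c))) * cis3 (w \<bullet> c))"
    unfolding cft_integral_def
    by (intro Bochner_Integration.integral_cong refl)
      (simp add: mult.assoc inner_add_right flip: cis3_add)
  also have "\<dots> = (LINT x|lebesgue. u x * cis3 (- (w \<bullet> x)) * cis3 (w \<bullet> c))"
    by (rule integral_lebesgue_translate(2)[of "\<lambda>x. u x * cis3 (- (w \<bullet> x)) * cis3 (w \<bullet> c)"])
      (rule borel_measurable_integrable[OF integrable_bounded_linear[OF bounded_linear_g3_mult_right int]])
  also have "\<dots> = cft_integral u w * cis3 (w \<bullet> c)"
    unfolding cft_integral_def by (rule integral_bounded_linear[OF bounded_linear_g3_mult_right int])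
  finally show ?thesis .
qed

text \<open>The sine is kept instead of its linear bound because it is a bounded multiplier, and so
  the estimate survives L2 limits.\<close>

lemma cft_integral_translate_diff_le:
  assumes u: "integrable lebesgue u" and u2: "nsq lebesgue u < \<infinity>"
  shows "ennreal ((2 * pi) ^ 3) * nsq lebesgue (\<lambda>x. u (x + c) - u x)
    \<le> nsq lebesgue (\<lambda>w. (2 * sin (w \<bullet> c / 2)) *\<^sub>R cft_integral u w)"
proof -
  have [measurable]: "u \<in> borel_measurable lebesgue" by (rule borel_measurable_integrable[OF u])
  have [measurable]: "(\<lambda>x. u (x + c)) \<in> borel_measurable lebesgue"
    by (rule borel_measurable_lebesgue_translate) measurable
  have uc: "integrable lebesgue (\<lambda>x. u (x + c))"
    using u by (simp add: integral_lebesgue_translate)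
  have "nsq lebesgue (\<lambda>x. u (x + c) - u x) \<le> 2 * nsq lebesgue (\<lambda>x. u (x + c)) + 2 * nsq lebesgue u"
    by (rule nsq_diff_le_2) measurable
  also have "\<dots> < \<infinity>"
    using u2 by (simp add: nsq_lebesgue_translate ennreal_mult_less_top)
  finally have "ennreal ((2 * pi) ^ 3) * nsq lebesgue (\<lambda>x. u (x + c) - u x)
      \<le> nsq lebesgue (cft_integral (\<lambda>x. u (x + c) - u x))"
    by (intro cft_integral_plancherel_le Bochner_Integration.integrable_diff uc u)
  also have "cft_integral (\<lambda>x. u (x + c) - u x) w = cft_integral u w * cis3 (w \<bullet> c) - cft_integral u w" for w
  proof -
    have "cft_integral (\<lambda>x. u (x + c) - u x) w = cft_integral (\<lambda>x. u (x + c)) w - cft_integral u w"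
      unfolding cft_integral_def left_diff_distrib
      by (intro Bochner_Integration.integral_diff integrable_mult_cis3 uc u) measurable
    then show ?thesis by (simp add: cft_integral_translate[OF u])
  qed
  then have "nsq lebesgue (cft_integral (\<lambda>x. u (x + c) - u x))
      = nsq lebesgue (\<lambda>w. (2 * sin (w \<bullet> c / 2)) *\<^sub>R cft_integral u w)"
    unfolding nsq_def by (simp only: norm_mult_cis3_minus_one)
  finally show ?thesis .
qed

text \<open>For integrable f the transform is the integral itself. Otherwise f and g are L2 limits
  of integrable functions and their transforms, and both inequalities pass to the limit because
  translation differences and multiplication by the sine are bounded operations on L2.\<close>

lemma has_cft_plancherel_le:
  assumes cft: "has_cft f g" and f2: "nsq lebesgue f < \<infinity>"
  shows "f \<in> borel_measurable lebesgue" "g \<in> borel_measurable lebesgue"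
    and "ennreal ((2 * pi) ^ 3) * nsq lebesgue f \<le> nsq lebesgue g"
    and "ennreal ((2 * pi) ^ 3) * nsq lebesgue (\<lambda>x. f (x + c) - f x)
      \<le> nsq lebesgue (\<lambda>w. (2 * sin (w \<bullet> c / 2)) *\<^sub>R g w)"
proof -
  have "f \<in> borel_measurable lebesgue \<and> g \<in> borel_measurable lebesgue \<and>
    ennreal ((2 * pi) ^ 3) * nsq lebesgue f \<le> nsq lebesgue g \<and>
    ennreal ((2 * pi) ^ 3) * nsq lebesgue (\<lambda>x. f (x + c) - f x)
      \<le> nsq lebesgue (\<lambda>w. (2 * sin (w \<bullet> c / 2)) *\<^sub>R g w)"
  proof (cases "integrable lebesgue f")
    case True
    with cft have g: "g = cft_integral f" by (simp add: has_cft_def)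
    show ?thesis
      unfolding g by (intro conjI borel_measurable_integrable True borel_measurable_cft_integral
          cft_integral_plancherel_le cft_integral_translate_diff_le f2)
  next
    case False
    then obtain h where f_meas [measurable]: "f \<in> borel_measurable lebesgue" "g \<in> borel_measurable lebesgue"
      and h: "\<And>n. integrable lebesgue (h n)" "\<And>n. nsq lebesgue (h n) < \<infinity>"
      and hf: "(\<lambda>n. nsq lebesgue (\<lambda>x. h n x - f x)) \<longlonglongrightarrow> 0"
      and hg: "(\<lambda>n. nsq lebesgue (\<lambda>w. cft_integral (h n) w - g w)) \<longlonglongrightarrow> 0"
      using cft by (auto simp: has_cft_def has_plancherel_cft_def square_integrable_def tendsto_L2_def nsq_def)
    have h_meas [measurable]: "h n \<in> borel_measurable lebesgue" "cft_integral (h n)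
        \<in> borel_measurable lebesgue" for n
      using h(1) by (auto intro: borel_measurable_cft_integral)
    have [measurable]: "(\<lambda>x. f (x + c)) \<in> borel_measurable lebesgue"
      "(\<lambda>x. h n (x + c)) \<in> borel_measurable lebesgue" for n
      by (rule borel_measurable_lebesgue_translate[OF f_meas(1)],
          rule borel_measurable_lebesgue_translate[OF h_meas(1)])
    have [measurable]: "(\<lambda>w. 2 * sin (w \<bullet> c / 2)) \<in> borel_measurable lebesgue"
      by (rule measurable_completion) simp
    have 1: "ennreal ((2 * pi) ^ 3) * nsq lebesgue f \<le> nsq lebesgue g"
      by (rule nsq_limit_le[OF _ _ _ _ hf hg cft_integral_plancherel_le[OF h]]) measurable
    \<comment> \<open>Regrouping gives the translate of h n - f minus h n - f itself; both have the
      same norm, which yields the factor 4.\<close>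
    have hf': "(\<lambda>n. nsq lebesgue (\<lambda>x. (h n (x + c) - h n x) - (f (x + c) - f x)))
        \<longlonglongrightarrow> 0"
    proof (rule tendsto_sandwich[OF _ _ tendsto_const])
      show "(\<lambda>n. 4 * nsq lebesgue (\<lambda>x. h n x - f x)) \<longlonglongrightarrow> 0"
        using ennreal_tendsto_cmult[OF _ hf, of 4] by simp
      have "nsq lebesgue (\<lambda>x. (h n (x + c) - h n x) - (f (x + c) - f x)) \<le> 4
          * nsq lebesgue (\<lambda>x. h n x - f x)" for n
      proof -
        have "nsq lebesgue (\<lambda>x. (h n (x + c) - h n x) - (f (x + c) - f x))
           = nsq lebesgue (\<lambda>x. (h n (x + c) - f (x + c)) - (h n x - f x))"
          by (simp add: algebra_simps)
        also have "\<dots> \<le> 2 * nsq lebesgue (\<lambda>x. h n (x + c) - f (x + c)) + 2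
            * nsq lebesgue (\<lambda>x. h n x - f x)"
          by (rule nsq_diff_le_2) measurable
        also have "nsq lebesgue (\<lambda>x. h n (x + c) - f (x + c)) = nsq lebesgue (\<lambda>x. h n x - f x)"
          by (rule nsq_lebesgue_translate[of "\<lambda>x. h n x - f x"]) measurable
        finally show ?thesis by (simp flip: distrib_right)
      qed
      then show "\<forall>\<^sub>F n in sequentially. nsq lebesgue (\<lambda>x. (h n (x + c) - h n x) - (f (x + c) - f x))
          \<le> 4 * nsq lebesgue (\<lambda>x. h n x - f x)" by simp
    qed simp
    \<comment> \<open>The multiplier is at most 2 in modulus, so squared norms grow by at most
      4.\<close>
    have hg': "(\<lambda>n. nsq lebesgue (\<lambda>w. (2 * sin (w \<bullet> c / 2)) *\<^sub>R cft_integral (h n) w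
        - (2 * sin (w \<bullet> c / 2)) *\<^sub>R g w)) \<longlonglongrightarrow> 0"
    proof (rule tendsto_sandwich[OF _ _ tendsto_const])
      show "(\<lambda>n. 4 * nsq lebesgue (\<lambda>w. cft_integral (h n) w - g w)) \<longlonglongrightarrow> 0"
        using ennreal_tendsto_cmult[OF _ hg, of 4] by simp
      have "nsq lebesgue (\<lambda>w. (2 * sin (w \<bullet> c / 2)) *\<^sub>R cft_integral (h n) w - (2
          * sin (w \<bullet> c / 2)) *\<^sub>R g w)
         \<le> 4 * nsq lebesgue (\<lambda>w. cft_integral (h n) w - g w)" for n
      proof -
        have "nsq lebesgue (\<lambda>w. (2 * sin (w \<bullet> c / 2)) *\<^sub>R cft_integral (h n) w - (2
            * sin (w \<bullet> c / 2)) *\<^sub>R g w)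
          \<le> (\<integral>\<^sup>+ w. 4 * ennreal ((norm (cft_integral (h n) w - g w))\<^sup>2) \<partial>lebesgue)"
          unfolding nsq_def
        proof (rule nn_integral_mono)
          fix w
          have "(2 * sin (w \<bullet> c / 2))\<^sup>2 \<le> 4"
            using abs_square_le_1[of "sin (w \<bullet> c / 2)"] by (simp add: power_mult_distrib)
          from mult_right_mono[OF this, of "(norm (cft_integral (h n) w - g w))\<^sup>2"]
          have "(norm ((2 * sin (w \<bullet> c / 2)) *\<^sub>R (cft_integral (h n) w - g w)))\<^sup>2
             \<le> 4 * (norm (cft_integral (h n) w - g w))\<^sup>2"
            by (simp add: power_mult_distrib)
          then show "ennreal ((norm ((2 * sin (w \<bullet> c / 2)) *\<^sub>R cft_integral (h n) w - (2
              * sin (w \<bullet> c / 2)) *\<^sub>R g w))\<^sup>2)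
             \<le> 4 * ennreal ((norm (cft_integral (h n) w - g w))\<^sup>2)"
            by (simp add: ennreal_leI scaleR_right_diff_distrib flip: ennreal_mult ennreal_numeral)
        qed
        also have "\<dots> = 4 * nsq lebesgue (\<lambda>w. cft_integral (h n) w - g w)"
          unfolding nsq_def by (rule nn_integral_cmult) measurable
        finally show ?thesis .
      qed
      then show "\<forall>\<^sub>F n in sequentially. nsq lebesgue (\<lambda>w. (2 * sin (w \<bullet> c / 2))
          *\<^sub>R cft_integral (h n) w
          - (2 * sin (w \<bullet> c / 2)) *\<^sub>R g w) \<le> 4 * nsq lebesgue (\<lambda>w. cft_integral (h n) w
              - g w)" by simp
    qed simp
    have 2: "ennreal ((2 * pi) ^ 3) * nsq lebesgue (\<lambda>x. f (x + c) - f x)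
      \<le> nsq lebesgue (\<lambda>w. (2 * sin (w \<bullet> c / 2)) *\<^sub>R g w)"
      by (rule nsq_limit_le[OF _ _ _ _ hf' hg' cft_integral_translate_diff_le[OF h]]) measurable
    from 1 2 show ?thesis by simp
  qed
  then show "f \<in> borel_measurable lebesgue" "g \<in> borel_measurable lebesgue"
    "ennreal ((2 * pi) ^ 3) * nsq lebesgue f \<le> nsq lebesgue g"
    "ennreal ((2 * pi) ^ 3) * nsq lebesgue (\<lambda>x. f (x + c) - f x)
      \<le> nsq lebesgue (\<lambda>w. (2 * sin (w \<bullet> c / 2)) *\<^sub>R g w)" by blast+
qed


section \<open>The uncertainty principle\<close>

text \<open>The discriminant argument of Cauchy-Schwarz: r = X / B is the optimal choice when B is
  positive, and for B = 0 the left side would be unbounded unless X = 0.\<close>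

lemma square_le_of_quadratic_bound:
  fixes X A B :: real
  assumes "\<And>r. 2 * r * X \<le> r\<^sup>2 * B + A" and "0 \<le> B"
  shows "X\<^sup>2 \<le> A * B"
proof (cases "B = 0")
  case True
  have "X = 0"
  proof (rule ccontr)
    assume "X \<noteq> 0"
    \<comment> \<open>This choice of r turns the hypothesis into A + 1 \<le> A.\<close>
    then show False using assms(1)[of "(A + 1) / (2 * X)"] True by simp
  qed
  then show ?thesis using True by simp
next
  case False
  then have B: "0 < B" using assms(2) by simp
  have "2 * (X / B) * X \<le> (X / B)\<^sup>2 * B + A" by (rule assms(1))
  then have "X\<^sup>2 / B \<le> A" using B by (simp add: power2_eq_square field_simps)
  then show ?thesis using B by (simp add: pos_divide_le_eq)
qed

text \<open>The cross term is a difference of squares, since the inner product of u - v and u + v is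
  |u|^2 - |v|^2. Nonnegativity of the left side then gives Cauchy-Schwarz with a free parameter
  k.\<close>

lemma norm_square_diff_sum:
  fixes u v :: "'a::real_inner"
  shows "(norm (k *\<^sub>R (u - v) - s *\<^sub>R (u + v)))\<^sup>2
    = k\<^sup>2 * (norm (u - v))\<^sup>2 + s\<^sup>2 * (norm (u + v))\<^sup>2 - 2 * k * s * ((norm u)\<^sup>2
        - (norm v)\<^sup>2)"
  unfolding power2_norm_eq_inner inner_simps
  by (simp add: inner_commute power2_eq_square algebra_simps)

text \<open>The hypothesis on the translation differences stands in for a bound on the L2 norm of the
  derivative of f in direction b.\<close>

lemma moment_translation_inequality:
  fixes f :: "'a::euclidean_space \<Rightarrow> 'b::{real_inner, second_countable_topology}"
  assumes f[measurable]: "f \<in> borel_measurable lebesgue"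
    and f0: "integrable lebesgue (\<lambda>x. (norm (f x))\<^sup>2)"
    and f2: "integrable lebesgue (\<lambda>x. (a \<bullet> x)\<^sup>2 * (norm (f x))\<^sup>2)"
    and B: "\<And>t. nsq lebesgue (\<lambda>x. f (x + t *\<^sub>R b) - f x) \<le> ennreal (t\<^sup>2 * B)" "0 \<le> B"
  shows "((a \<bullet> b) * (LINT x|lebesgue. (norm (f x))\<^sup>2))\<^sup>2
    \<le> 4 * (LINT x|lebesgue. (a \<bullet> x)\<^sup>2 * (norm (f x))\<^sup>2) * B"
proof -
  have [measurable]: "(\<lambda>x. a \<bullet> x) \<in> borel_measurable lebesgue"
    by (intro measurable_completion) simp
  \<comment> \<open>The first moment is controlled by the zeroth and the second, as |y| \<le> 1 +
    y^2.\<close>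
  have f1: "integrable lebesgue (\<lambda>x. (a \<bullet> x) * (norm (f x))\<^sup>2)"
  proof (rule Bochner_Integration.integrable_bound[OF Bochner_Integration.integrable_add[OF f0 f2]])
    have "\<bar>a \<bullet> x\<bar> \<le> 1 + (a \<bullet> x)\<^sup>2" for x
      using mult_le_sum_squares[of 1 "\<bar>a \<bullet> x\<bar>"] by simp
    from mult_right_mono[OF this zero_le_power2]
    show "AE x in lebesgue. norm ((a \<bullet> x) * (norm (f x))\<^sup>2) \<le> norm ((norm (f x))\<^sup>2
        + (a \<bullet> x)\<^sup>2 * (norm (f x))\<^sup>2)"
      by (simp add: abs_mult distrib_right)
  qed measurable
  have trans [measurable]: "(\<lambda>x. f (x + v)) \<in> borel_measurable lebesgue" for v
    by (rule borel_measurable_lebesgue_translate) measurable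
  define m0 where "m0 = (LINT x|lebesgue. (norm (f x))\<^sup>2)"
  define m1 where "m1 = (LINT x|lebesgue. (a \<bullet> x) * (norm (f x))\<^sup>2)"
  define m2 where "m2 = (LINT x|lebesgue. (a \<bullet> x)\<^sup>2 * (norm (f x))\<^sup>2)"
  \<comment> \<open>Substituting x - v for x moves the translation from f to the weight, whose
    powers are then expanded.\<close>
  have shift1: "integrable lebesgue (\<lambda>x. (a \<bullet> x) * (norm (f (x + v)))\<^sup>2)"
    "(LINT x|lebesgue. (a \<bullet> x) * (norm (f (x + v)))\<^sup>2) = m1 - (a \<bullet> v) * m0" for v
  proof -
    have eq: "(a \<bullet> x - a \<bullet> v) * (norm (f x))\<^sup>2 = (a \<bullet> x) * (norm (f x))\<^sup>2
        - (a \<bullet> v) * (norm (f x))\<^sup>2" for x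
      by (simp add: left_diff_distrib)
    show "integrable lebesgue (\<lambda>x. (a \<bullet> x) * (norm (f (x + v)))\<^sup>2)"
      "(LINT x|lebesgue. (a \<bullet> x) * (norm (f (x + v)))\<^sup>2) = m1 - (a \<bullet> v) * m0"
      using integral_lebesgue_translate[of "\<lambda>x. (a \<bullet> x - a \<bullet> v) * (norm (f x))\<^sup>2" v] f0 f1
      unfolding m0_def m1_def by (simp_all add: inner_add_right eq)
  qed
  have shift2: "integrable lebesgue (\<lambda>x. (a \<bullet> x)\<^sup>2 * (norm (f (x + v)))\<^sup>2)"
    "(LINT x|lebesgue. (a \<bullet> x)\<^sup>2 * (norm (f (x + v)))\<^sup>2) = m2 - 2 * (a \<bullet> v) * m1
        + (a \<bullet> v)\<^sup>2 * m0" for v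
  proof -
    have eq: "(a \<bullet> x - a \<bullet> v)\<^sup>2 * (norm (f x))\<^sup>2 = (a \<bullet> x)\<^sup>2 * (norm (f x))\<^sup>2
        - 2 * (a \<bullet> v) * ((a \<bullet> x) * (norm (f x))\<^sup>2) + (a \<bullet> v)\<^sup>2
            * (norm (f x))\<^sup>2" for x
      by (simp add: power2_diff algebra_simps)
    show "integrable lebesgue (\<lambda>x. (a \<bullet> x)\<^sup>2 * (norm (f (x + v)))\<^sup>2)"
      "(LINT x|lebesgue. (a \<bullet> x)\<^sup>2 * (norm (f (x + v)))\<^sup>2) = m2 - 2 * (a \<bullet> v) * m1
          + (a \<bullet> v)\<^sup>2 * m0"
      using integral_lebesgue_translate[of "\<lambda>x. (a \<bullet> x - a \<bullet> v)\<^sup>2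
          * (norm (f x))\<^sup>2" v] f0 f1 f2
      unfolding m0_def m1_def m2_def by (simp_all add: inner_add_right eq)
  qed
  have ineq: "2 * r * ((a \<bullet> b) * m0) \<le> r\<^sup>2 * B + 4 * m2 + t\<^sup>2 * ((a \<bullet> b)\<^sup>2
      * m0)" if t: "0 < t" for r t
  proof -
    \<comment> \<open>With symmetric shifts the first moments cancel in the sum of the two second
      moments, leaving 2 m2 plus a term of order t^2.\<close>
    let ?p = "(t / 2) *\<^sub>R b" and ?m = "- ((t / 2) *\<^sub>R b)"
    let ?d = "\<lambda>x. f (x + ?p) - f (x + ?m)"
    have half: "t *\<^sub>R b = (t / 2) *\<^sub>R b + (t / 2) *\<^sub>R b"
      by (simp flip: scaleR_left_distrib)
    have "x + ?m + t *\<^sub>R b = x + ?p" for x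
      by (subst half) simp
    then have "nsq lebesgue ?d = nsq lebesgue (\<lambda>x. f (x + t *\<^sub>R b) - f x)"
      using nsq_lebesgue_translate[of "\<lambda>x. f (x + t *\<^sub>R b) - f x" ?m, OF borel_measurable_diff[OF trans f]]
      by (simp only:)
    with B(1)[of t] have d: "nsq lebesgue ?d \<le> ennreal (t\<^sup>2 * B)" by simp
    have d2: "integrable lebesgue (\<lambda>x. (norm (?d x))\<^sup>2)"
      by (rule integrable_norm_square_iff[THEN iffD2,
            OF borel_measurable_diff[OF trans trans] le_less_trans[OF d]]) simp
    from d have d': "(LINT x|lebesgue. (norm (?d x))\<^sup>2) \<le> t\<^sup>2 * B"
      using B(2) by (subst (asm) nsq_eq_integral[OF d2]) (simp add: ennreal_le_iff)
    \<comment> \<open>The factor 1/t forms the difference quotient, so k^2 t^2 B becomes r^2 B. The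
      minus sign cancels the one in the shifted first moments, whose difference is -t (a \<bullet>
      b) m0.\<close>
    define k where "k = - (r / t)"
    have pw: "2 * k * ((a \<bullet> x) * (norm (f (x + ?p)))\<^sup>2 - (a \<bullet> x) * (norm (f (x + ?m)))\<^sup>2)
      \<le> k\<^sup>2 * (norm (?d x))\<^sup>2
        + 2 * ((a \<bullet> x)\<^sup>2 * (norm (f (x + ?p)))\<^sup>2 + (a \<bullet> x)\<^sup>2 * (norm (f (x
            + ?m)))\<^sup>2)" for x
    proof -
      let ?u = "f (x + ?p)" and ?v = "f (x + ?m)"
      have "0 \<le> (norm (k *\<^sub>R (?u - ?v) - (a \<bullet> x) *\<^sub>R (?u + ?v)))\<^sup>2" by simp
      also have "\<dots> = k\<^sup>2 * (norm (?u - ?v))\<^sup>2 + (a \<bullet> x)\<^sup>2 * (norm (?u + ?v))\<^sup>2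
          - 2 * k * (a \<bullet> x) * ((norm ?u)\<^sup>2 - (norm ?v)\<^sup>2)"
        by (rule norm_square_diff_sum)
      also have "\<dots> \<le> k\<^sup>2 * (norm (?u - ?v))\<^sup>2 + (a \<bullet> x)\<^sup>2 * (2 * (norm ?u)\<^sup>2
          + 2 * (norm ?v)\<^sup>2)
          - 2 * k * (a \<bullet> x) * ((norm ?u)\<^sup>2 - (norm ?v)\<^sup>2)"
        using norm_add_square_le[of 1 ?u ?v]
        by (intro diff_right_mono add_left_mono mult_left_mono) auto
      finally show ?thesis by (simp add: algebra_simps)
    qed
    have "(LINT x|lebesgue. 2 * k * ((a \<bullet> x) * (norm (f (x + ?p)))\<^sup>2 - (a \<bullet> x) * (norm (f (x
        + ?m)))\<^sup>2))
      \<le> (LINT x|lebesgue. k\<^sup>2 * (norm (?d x))\<^sup>2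
        + 2 * ((a \<bullet> x)\<^sup>2 * (norm (f (x + ?p)))\<^sup>2 + (a \<bullet> x)\<^sup>2 * (norm (f (x
            + ?m)))\<^sup>2))"
      by (rule integral_mono[OF _ _ pw]) (intro integrable_mult_right Bochner_Integration.integrable_add
          Bochner_Integration.integrable_diff shift1 shift2 d2)+
    also have "(LINT x|lebesgue. 2 * k * ((a \<bullet> x) * (norm (f (x + ?p)))\<^sup>2 - (a \<bullet> x)
        * (norm (f (x + ?m)))\<^sup>2))
        = 2 * k * (m1 - (a \<bullet> ?p) * m0 - (m1 - (a \<bullet> ?m) * m0))"
      by (simp only: integral_mult_right_zero Bochner_Integration.integral_diff[OF shift1(1) shift1(1)] shift1(2))
    also have "(LINT x|lebesgue. k\<^sup>2 * (norm (?d x))\<^sup>2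
        + 2 * ((a \<bullet> x)\<^sup>2 * (norm (f (x + ?p)))\<^sup>2 + (a \<bullet> x)\<^sup>2 * (norm (f (x
            + ?m)))\<^sup>2))
      = k\<^sup>2 * (LINT x|lebesgue. (norm (?d x))\<^sup>2) + 2 * (m2 - 2 * (a \<bullet> ?p) * m1
          + (a \<bullet> ?p)\<^sup>2 * m0
         + (m2 - 2 * (a \<bullet> ?m) * m1 + (a \<bullet> ?m)\<^sup>2 * m0))"
      using shift2 d2 by (simp only: integral_mult_right_zero Bochner_Integration.integral_add
          integrable_mult_right Bochner_Integration.integrable_add)
    also have "\<dots> \<le> k\<^sup>2 * (t\<^sup>2 * B) + 2 * (m2 - 2 * (a \<bullet> ?p) * m1
        + (a \<bullet> ?p)\<^sup>2 * m0
         + (m2 - 2 * (a \<bullet> ?m) * m1 + (a \<bullet> ?m)\<^sup>2 * m0))"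
      using d' by (intro add_right_mono mult_left_mono) auto
    finally show ?thesis
      using t by (simp add: k_def power2_eq_square field_simps)
  qed
  have "2 * r * ((a \<bullet> b) * m0) \<le> r\<^sup>2 * B + 4 * m2" for r
  proof (rule LIMSEQ_le_const)
    have "(\<lambda>n. r\<^sup>2 * B + 4 * m2 + (1 / real (Suc n))\<^sup>2 * ((a \<bullet> b)\<^sup>2 * m0))
        \<longlonglongrightarrow>
        r\<^sup>2 * B + 4 * m2 + 0\<^sup>2 * ((a \<bullet> b)\<^sup>2 * m0)"
      by (intro tendsto_intros LIMSEQ_Suc[OF lim_1_over_n])
    then show "(\<lambda>n. r\<^sup>2 * B + 4 * m2 + (1 / real (Suc n))\<^sup>2 * ((a \<bullet> b)\<^sup>2 * m0))
        \<longlonglongrightarrow> r\<^sup>2 * B + 4 * m2"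
      by simp
  qed (intro exI allI impI ineq, simp)
  from square_le_of_quadratic_bound[OF this B(2)] show ?thesis
    by (simp add: m0_def m2_def)
qed

theorem theorem5p1:
  fixes f cft_f :: "real^3 \<Rightarrow> g3" and F :: ennreal and a b :: "real^3"
  assumes "has_cft f cft_f"
    and "(\<integral>\<^sup>+ x. ennreal ((norm (f x))\<^sup>2) \<partial>lebesgue) = F"
    and "F < \<infinity>"
  shows "(\<integral>\<^sup>+ x. ennreal ((a \<bullet> x)\<^sup>2) * ennreal ((norm (f x))\<^sup>2) \<partial>lebesgue) *
         (\<integral>\<^sup>+ \<omega>. ennreal ((b \<bullet> \<omega>)\<^sup>2)
             * ennreal ((norm (cft_f \<omega>))\<^sup>2) \<partial>lebesgue)
       \<ge> ennreal ((a \<bullet> b)\<^sup>2 * ((2 * pi) ^ 3 / 4)) * F\<^sup>2"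
proof -
  let ?g = cft_f
  let ?A = "\<integral>\<^sup>+ x. ennreal ((a \<bullet> x)\<^sup>2) * ennreal ((norm (f x))\<^sup>2) \<partial>lebesgue"
  let ?B = "\<integral>\<^sup>+ w. ennreal ((b \<bullet> w)\<^sup>2) * ennreal ((norm (?g w))\<^sup>2) \<partial>lebesgue"
  define p :: real where "p = (2 * pi) ^ 3"
  have p: "0 < p" by (simp add: p_def)
  have F: "F = nsq lebesgue f" using assms(2) by (simp add: nsq_def)
  have f2: "nsq lebesgue f < \<infinity>" using assms(3) F by simp
  note cft = has_cft_plancherel_le[OF assms(1) f2, folded p_def]
  note [measurable] = cft(1,2)
  show ?thesis
  \<comment> \<open>If one of these holds, the right side is 0.\<close>
  proof (cases "a \<bullet> b = 0 \<or> F = 0")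
    case False
    then have a: "a \<noteq> 0" and b: "b \<noteq> 0" and F0: "F \<noteq> 0" by auto
    have A0: "?A \<noteq> 0"
      using nsq_weighted_eq_0[OF cft(1) a] F F0 by auto
    \<comment> \<open>If ?B = 0, then the transform vanishes almost everywhere, so f does too by Plancherel.\<close>
    have B0: "?B \<noteq> 0"
    proof
      assume "?B = 0"
      then have "nsq lebesgue ?g = 0" by (rule nsq_weighted_eq_0[OF cft(2) b])
      then show False using cft(3) F F0 p by simp
    qed
    \<comment> \<open>Both moments are now known to be nonzero, so an infinite one makes the product
      infinite.\<close>
    show ?thesis
    proof (cases "?A = \<infinity> \<or> ?B = \<infinity>")
      case True
      then have "?A * ?B = \<infinity>" using A0 B0 by (auto simp: ennreal_mult_eq_top_iff)
      then show ?thesis by simp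
    next
      case False
      then have A: "?A < \<infinity>" and "?B < \<infinity>" by (auto simp: less_top)
      then obtain B where B: "0 \<le> B" "?B = ennreal B"
        by (cases ?B rule: ennreal_cases) auto
      have f0: "integrable lebesgue (\<lambda>x. (norm (f x))\<^sup>2)"
        using f2 by (simp add: integrable_norm_square_iff)
      have F': "F = ennreal (LINT x|lebesgue. (norm (f x))\<^sup>2)"
        using nsq_eq_integral[OF f0] F by simp
      have fa: "integrable lebesgue (\<lambda>x. (a \<bullet> x)\<^sup>2 * (norm (f x))\<^sup>2)"
        using A by (simp add: integrable_iff_bounded ennreal_mult)
      have A': "?A = ennreal (LINT x|lebesgue. (a \<bullet> x)\<^sup>2 * (norm (f x))\<^sup>2)"
        using nn_integral_eq_integral[OF fa] by (simp add: ennreal_mult)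
      \<comment> \<open>The frequency moment B, divided by the Plancherel constant p, supplies the
        bound required by \<open>moment_translation_inequality\<close>.\<close>
      have D: "nsq lebesgue (\<lambda>x. f (x + t *\<^sub>R b) - f x) \<le> ennreal (t\<^sup>2 * (B / p))" for t
      proof -
        have "ennreal p * nsq lebesgue (\<lambda>x. f (x + t *\<^sub>R b) - f x)
          \<le> nsq lebesgue (\<lambda>w. (2 * sin (w \<bullet> (t *\<^sub>R b) / 2)) *\<^sub>R ?g w)" by (rule cft(4))
        also have "\<dots> \<le> (\<integral>\<^sup>+ w. ennreal (t\<^sup>2) * (ennreal ((b \<bullet> w)\<^sup>2)
            * ennreal ((norm (?g w))\<^sup>2)) \<partial>lebesgue)"
          unfolding nsq_def
        proof (rule nn_integral_mono)
          fix w
          have "\<bar>2 * sin (w \<bullet> (t *\<^sub>R b) / 2)\<bar> \<le> \<bar>t * (b \<bullet> w)\<bar>"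
            using abs_sin_x_le_abs_x[of "w \<bullet> (t *\<^sub>R b) / 2"] by (simp add: inner_commute abs_mult)
          then have "(2 * sin (w \<bullet> (t *\<^sub>R b) / 2))\<^sup>2 \<le> t\<^sup>2 * (b \<bullet> w)\<^sup>2"
            by (simp add: abs_le_square_iff power_mult_distrib)
          from mult_right_mono[OF this, of "(norm (?g w))\<^sup>2"]
          have "(norm ((2 * sin (w \<bullet> (t *\<^sub>R b) / 2)) *\<^sub>R ?g w))\<^sup>2 \<le> t\<^sup>2
              * ((b \<bullet> w)\<^sup>2 * (norm (?g w))\<^sup>2)"
            by (simp add: power_mult_distrib mult.assoc)
          then show "ennreal ((norm ((2 * sin (w \<bullet> (t *\<^sub>R b) / 2)) *\<^sub>R ?g w))\<^sup>2)
            \<le> ennreal (t\<^sup>2) * (ennreal ((b \<bullet> w)\<^sup>2) * ennreal ((norm (?g w))\<^sup>2))"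
            by (simp add: ennreal_leI flip: ennreal_mult)
        qed
        also have "\<dots> = ennreal (t\<^sup>2 * B)"
          using B by (subst nn_integral_cmult) (auto simp: ennreal_mult)
        finally have "ennreal (1 / p) * (ennreal p * nsq lebesgue (\<lambda>x. f (x + t *\<^sub>R b) - f x))
            \<le> ennreal (1 / p) * ennreal (t\<^sup>2 * B)"
          by (rule mult_left_mono) simp
        then show ?thesis
          using p B by (simp add: mult.assoc[symmetric] flip: ennreal_mult)
      qed
      have ineq: "((a \<bullet> b) * (LINT x|lebesgue. (norm (f x))\<^sup>2))\<^sup>2
          \<le> 4 * (LINT x|lebesgue. (a \<bullet> x)\<^sup>2 * (norm (f x))\<^sup>2) * (B / p)"
        by (rule moment_translation_inequality[OF cft(1) f0 fa D]) (use B p in simp)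
      \<comment> \<open>The factor p/4 cancels the 4/p on the right of \<open>ineq\<close>, leaving
        the product of the two moments.\<close>
      have "ennreal ((a \<bullet> b)\<^sup>2 * (p / 4)) * F\<^sup>2
          = ennreal (((a \<bullet> b) * (LINT x|lebesgue. (norm (f x))\<^sup>2))\<^sup>2 * (p / 4))"
        using p by (simp add: F' ennreal_power power_mult_distrib mult_ac flip: ennreal_mult)
      also have "\<dots> \<le> ennreal (4 * (LINT x|lebesgue. (a \<bullet> x)\<^sup>2 * (norm (f x))\<^sup>2)
          * (B / p) * (p / 4))"
        using p by (intro ennreal_leI mult_right_mono ineq) simp
      also have "\<dots> = ?A * ?B"
        unfolding A' B(2) using p B(1) by (simp flip: ennreal_mult)
      finally show ?thesis by (simp add: p_def)
    qed
  qed auto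
qed

end
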